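(* Let $m\geq 2$ be a positive integer and let $\mathbb{K}$ be $\mathbb{R}$ or $\mathbb{C}$. (a) If $(r,p)\in \left([1,2]\times[2,2m)\right)\cup\left([1,\infty)\times[2m,\infty]\right)$, then there is a constant $D_{m,r,p}^{\mathbb{K}}>0$ (not depending on $n$) such that $$\left(\sum_{j_1,\dots,j_m=1}^{n}\left|T(e_{j_1},\dots,e_{j_m})\right|^{r}\right)^{\frac1r}\leq D_{m,r,p}^{\mathbb{K}}\, n^{\max\left\{\frac{2mr+2mp-mpr-pr}{2pr},\,0\right\}}\,\|T\|$$ for all $m$-linear forms $T:\ell_p^n\times\cdots\times\ell_p^n\to\mathbb{K}$ and all positive integers $n$. Moreover, the exponent $\max\left\{\frac{2mr+2mp-mpr-pr}{2pr},0\right\}$ is optimal. (b) If $(r,p)\in[2,\infty)\times(m,2m]$, then there is a constant $D_{m,r,p}^{\mathbb{K}}>0$ (not depending on $n$) such that $$\left(\sum_{j_1,\dots,j_m=1}^{n}\left|T(e_{j_1},\dots,e_{j_m})\right|^{r}\right)^{\frac1r}\leq D_{m,r,p}^{\mathbb{K}}\, n^{\max\left\{\frac{p+mr-rp}{pr},\,0\right\}}\,\|T\|$$ for all $m$-linear forms $T:\ell_p^n\times\cdots\times\ell_p^n\to\mathbb{K}$ and all positive integers $n$. Moreover, the exponent $\max\left\{\frac{p+mr-rp}{pr},0\right\}$ is optimal.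
   Context: $\ell_p^n$ denotes $\mathbb{K}^n$ with the $\ell_p$-norm (the sup norm if $p=\infty$), and $e_1,\dots,e_n$ are its canonical unit vectors. For an $m$-linear form $T:\ell_p^n\times\cdots\times\ell_p^n\to\mathbb{K}$ ($m$ factors), $\|T\|=\sup\{|T(x^{(1)},\dots,x^{(m)})| : \|x^{(i)}\|_{\ell_p^n}\le 1,\ i=1,\dots,m\}$. When $p=\infty$, expressions in $p$ are understood as their limits as $p\to\infty$; thus $\frac{2mr+2mp-mpr-pr}{2pr}$ is read as $\frac{2m-mr-r}{2r}$. An exponent $t$ of $n$ in such an inequality is called optimal (for given $m,r,p,\mathbb{K}$) if it cannot be replaced by a smaller one: whenever $s\in\mathbb{R}$ is such that there is a constant $D>0$, independent of $n$, with $\left(\sum_{j_1,\dots,j_m=1}^{n}|T(e_{j_1},\dots,e_{j_m})|^{r}\right)^{1/r}\le D\,n^{s}\|T\|$ for all positive integers $n$ and all $m$-linear forms $T:\ell_p^n\times\cdots\times\ell_p^n\to\mathbb{K}$, then $s\ge t$. *)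

theory Defs
  imports
    Complex_Main
    "HOL-Library.FuncSet"
    "HOL-Library.Extended_Real"
    "Jordan_Normal_Form.Matrix"
begin

text \<open>
  The space \<open>\<ell>\<^sub>p\<^sup>n\<close> is \<open>carrier_vec n\<close> with the norm below; \<open>p\<close> ranges over the extended
  reals so that \<open>p = \<infinity>\<close> is included. In dimension 0 and \<open>p = \<infinity>\<close> the value is
  unspecified; only dimensions \<open>n > 0\<close> are used.
\<close>

definition lp_norm :: "ereal \<Rightarrow> 'a::real_normed_field vec \<Rightarrow> real" where
  "lp_norm p v =
     (if p = \<infinity> then Max ((\<lambda>j. norm (vec_index v j)) ` {..<dim_vec v})
      else (\<Sum>j<dim_vec v. norm (vec_index v j) powr real_of_ereal p) powr (1 / real_of_ereal p))"

text \<open>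
  An \<open>m\<close>-tuple of vectors is an extensional function on \<open>{..<m}\<close>, and an \<open>m\<close>-linear form is
  a function on such tuples; its values elsewhere are irrelevant. Indices start at 0.
\<close>

definition vec_tuples :: "nat \<Rightarrow> nat \<Rightarrow> (nat \<Rightarrow> 'a vec) set" where
  "vec_tuples m n = {..<m} \<rightarrow>\<^sub>E carrier_vec n"

definition multilinear_form ::
  "nat \<Rightarrow> nat \<Rightarrow> ((nat \<Rightarrow> 'a::real_normed_field vec) \<Rightarrow> 'a) \<Rightarrow> bool" where
  "multilinear_form m n T \<longleftrightarrow>
     (\<forall>x \<in> vec_tuples m n. \<forall>i<m. \<forall>u \<in> carrier_vec n.
        (\<forall>v \<in> carrier_vec n. T (x(i := u + v)) = T (x(i := u)) + T (x(i := v))) \<and>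
        (\<forall>c. T (x(i := c \<cdot>\<^sub>v u)) = c * T (x(i := u))))"

text \<open>
  The supremum is taken in the reals; for an \<open>m\<close>-linear form on finite-dimensional spaces
  the set is nonempty and bounded above.
\<close>

definition form_norm ::
  "ereal \<Rightarrow> nat \<Rightarrow> nat \<Rightarrow> ((nat \<Rightarrow> 'a::real_normed_field vec) \<Rightarrow> 'a) \<Rightarrow> real" where
  "form_norm p m n T =
     Sup {norm (T x) | x. x \<in> vec_tuples m n \<and> (\<forall>i<m. lp_norm p (x i) \<le> 1)}"

definition coeff_norm ::
  "real \<Rightarrow> nat \<Rightarrow> nat \<Rightarrow> ((nat \<Rightarrow> 'a::real_normed_field vec) \<Rightarrow> 'a) \<Rightarrow> real" where
  "coeff_norm r m n T =
     (\<Sum>j \<in> {..<m} \<rightarrow>\<^sub>E {..<n}. norm (T (\<lambda>i\<in>{..<m}. unit_vec n (j i))) powr r) powr (1 / r)"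

definition hardy_littlewood_ineq ::
  "'a::real_normed_field itself \<Rightarrow> nat \<Rightarrow> real \<Rightarrow> ereal \<Rightarrow> real \<Rightarrow> bool" where
  "hardy_littlewood_ineq _ m r p s \<longleftrightarrow>
     (\<exists>D>0. \<forall>n>0. \<forall>T :: (nat \<Rightarrow> 'a vec) \<Rightarrow> 'a. multilinear_form m n T \<longrightarrow>
        coeff_norm r m n T \<le> D * real n powr s * form_norm p m n T)"

definition optimal_exponent ::
  "'a::real_normed_field itself \<Rightarrow> nat \<Rightarrow> real \<Rightarrow> ereal \<Rightarrow> real \<Rightarrow> bool" where
  "optimal_exponent K m r p t \<longleftrightarrow> (\<forall>s. hardy_littlewood_ineq K m r p s \<longrightarrow> t \<le> s)"

text \<open>
  At \<open>p = \<infinity>\<close> the first exponent is its limit as \<open>p \<rightarrow> \<infinity>\<close>. The second one is only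
  needed for finite \<open>p\<close>.
\<close>

definition exponent_a :: "nat \<Rightarrow> real \<Rightarrow> ereal \<Rightarrow> real" where
  "exponent_a m r p =
     max (if p = \<infinity> then (2 * real m - real m * r - r) / (2 * r)
          else let q = real_of_ereal p in
            (2 * real m * r + 2 * real m * q - real m * q * r - q * r) / (2 * q * r)) 0"

definition exponent_b :: "nat \<Rightarrow> real \<Rightarrow> real \<Rightarrow> real" where
  "exponent_b m r p = max ((p + real m * r - r * p) / (p * r)) 0"

end

theory Submission
  imports Defs "HOL-Analysis.L2_Norm" "HOL-Analysis.Convex"
begin

text \<open>
  Upper bounds. It suffices to treat real arrays, since a complex array splits into its real and
  imaginary parts. Khinchin's inequality in all variables but one gives, on products of sup-norm
  balls, \<open>\<Sum>\<^sub>l (\<Sum> {\<bar>t\<^sub>j\<bar>\<^sup>2 | j\<^sub>i = l})\<^bsup>1/2\<^esup> \<le> 2\<^bsup>m-1\<^esup>\<close> for each \<open>i\<close>. The sup-norm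
  balls are then replaced by \<open>\<ell>\<^sub>p\<close>-balls one variable at a time: multiplying a variable \<open>u\<close> by a
  weight \<open>w\<close> in the \<open>\<ell>\<^sub>p\<close>-ball gives a family of bounds, and the right choice of \<open>w\<close> raises the outer
  exponent from \<open>\<kappa>\<close> to \<open>\<mu>\<close> with \<open>1/\<mu> = 1/\<kappa> - 1/p\<close>, so that after all \<open>m\<close> variables it is
  \<open>p/(p-m)\<close>. If this is at most 2 (that is, \<open>p \<ge> 2m\<close>), Blei's interpolation of the \<open>m\<close> mixed norms
  finishes the proof; otherwise the mixed norms have already become the full \<open>\<ell>\<close>-norm of exponent
  \<open>p/(p-m)\<close>. The remaining pairs \<open>(r,p)\<close> follow by comparing norms in dimension \<open>n\<close> or \<open>n\<^sup>m\<close>.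

  Optimality. A product of coordinates shows that the exponent is nonnegative, the diagonal form
  gives the exponent of part (b), and a random form with coefficients \<open>\<plusminus>1\<close> whose norm on
  \<open>\<ell>\<^sub>2\<close>-balls is \<open>O(\<surd>n)\<close> gives the exponent of part (a).
\<close>

subsection \<open>Sums of powers\<close>

text \<open>After the weight of a variable \<open>u\<close> has been absorbed into the array, it is
  constant on the slices \<open>j u = l\<close> but varies inside the slices of every other
  direction. Raising the outer exponent is therefore plain duality for direction \<open>u\<close>.
  For the other directions the weight is hidden under the inner sum of squares, and they have to be
  recovered from direction \<open>u\<close> by a weight built from the slices already controlled;
  this transposition is the main obstacle. Lowering r from q costs m(1/r - 1/q) in the exponent of
  n, because there are n^m coefficients. Lowering p from p' costs m(1/p - 1/p'), because there are m
  variables. Part (a) lowers r and, below 2m, also p. Part (b) lowers only p: lowering r from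
  p/(p-m) would cost m times the claimed exponent. For the lower bounds, random signs are needed
  only at p = 2, since the l_p-ball lies in n^(1/2 - 1/p) times the l_2-ball and this inclusion
  loses nothing in the final exponent. The signs are real, so one array serves both fields.\<close>

lemma weighted_Young:
  fixes a b \<alpha> :: real
  assumes "0 \<le> a" "0 \<le> b" "0 < \<alpha>" "\<alpha> < 1"
  shows "a powr \<alpha> * b powr (1 - \<alpha>) \<le> \<alpha> * a + (1 - \<alpha>) * b"
proof (cases "a = 0 \<or> b = 0")
  case True
  then show ?thesis using assms by auto
next
  case False
  then show ?thesis using assms Youngs_inequality_0[of \<alpha> "1 - \<alpha>" a b] by simp
qed

lemma weighted_Young_le_add:
  fixes a b \<alpha> :: real
  assumes "0 \<le> a" "0 \<le> b" "0 < \<alpha>" "\<alpha> < 1"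
  shows "a powr \<alpha> * b powr (1 - \<alpha>) \<le> a + b"
proof -
  have "a powr \<alpha> * b powr (1 - \<alpha>) \<le> \<alpha> * a + (1 - \<alpha>) * b"
    using assms by (rule weighted_Young)
  also have "\<dots> \<le> 1 * a + 1 * b"
    using assms by (intro add_mono mult_right_mono) auto
  finally show ?thesis by simp
qed

lemma Holder_sum_powr:
  fixes f g :: "'b \<Rightarrow> real"
  assumes "finite V" "\<And>v. v \<in> V \<Longrightarrow> 0 \<le> f v" "\<And>v. v \<in> V \<Longrightarrow> 0 \<le> g v" "0 < \<theta>" "\<theta> < 1"
  shows "(\<Sum>v\<in>V. f v powr \<theta> * g v powr (1 - \<theta>)) \<le> sum f V powr \<theta> * sum g V powr (1 - \<theta>)"
proof (cases "sum f V = 0 \<or> sum g V = 0")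
  case True
  then have "\<forall>v\<in>V. f v powr \<theta> * g v powr (1 - \<theta>) = 0"
    using assms sum_nonneg_eq_0_iff[of V f] sum_nonneg_eq_0_iff[of V g] by auto
  then have "(\<Sum>v\<in>V. f v powr \<theta> * g v powr (1 - \<theta>)) = 0" by (intro sum.neutral) auto
  then show ?thesis by simp
next
  case False
  define X Y where "X = sum f V" and "Y = sum g V"
  have XY: "X > 0" "Y > 0" using False assms sum_nonneg[of V f] sum_nonneg[of V g]
    unfolding X_def Y_def by force+
  have "(\<Sum>v\<in>V. f v powr \<theta> * g v powr (1 - \<theta>)) / (X powr \<theta> * Y powr (1 - \<theta>))
    = (\<Sum>v\<in>V. (f v / X) powr \<theta> * (g v / Y) powr (1 - \<theta>))"
    unfolding sum_divide_distrib using assms XY by (intro sum.cong) (auto simp: powr_divide)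
  also have "\<dots> \<le> (\<Sum>v\<in>V. \<theta> * (f v / X) + (1 - \<theta>) * (g v / Y))"
    using assms XY by (intro sum_mono weighted_Young) auto
  also have "\<dots> = \<theta> * ((\<Sum>v\<in>V. f v) / X) + (1 - \<theta>) * ((\<Sum>v\<in>V. g v) / Y)"
    by (simp only: sum.distrib sum_divide_distrib sum_distrib_left)
  also have "\<dots> = 1" using XY unfolding X_def[symmetric] Y_def[symmetric] by simp
  finally show ?thesis using XY by (simp add: pos_divide_le_eq X_def Y_def)
qed

text \<open>Hoelder against a constant function: with the sum of q-th powers normalised, it is the
  pointwise Young inequality with second argument \<open>1 / N\<close>, summed over
  \<open>S\<close>.\<close>

lemma sum_powr_le_card:
  fixes f :: "'b \<Rightarrow> real"
  assumes "finite S" "0 < N" "real (card S) \<le> N" "\<And>x. x \<in> S \<Longrightarrow> 0 \<le> f x" "0 < p" "p \<le> q"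
    and "(\<Sum>x\<in>S. f x powr q) \<le> 1"
  shows "(\<Sum>x\<in>S. f x powr p) \<le> N powr (1 - p / q)"
proof (cases "p = q")
  case True
  then show ?thesis using assms by simp
next
  case False
  define \<alpha> where "\<alpha> = p / q"
  have \<alpha>: "0 < \<alpha>" "\<alpha> < 1" using assms False unfolding \<alpha>_def by auto
  have N: "N powr (- (1 - \<alpha>)) = (1 / N) powr (1 - \<alpha>)"
    unfolding powr_minus_divide using assms by (simp add: powr_divide)
  have "(\<Sum>x\<in>S. f x powr p) * N powr (- (1 - \<alpha>))
      = (\<Sum>x\<in>S. (f x powr q) powr \<alpha> * (1 / N) powr (1 - \<alpha>))"
    unfolding sum_distrib_right N using assms by (simp add: powr_powr \<alpha>_def)
  also have "\<dots> \<le> (\<Sum>x\<in>S. \<alpha> * (f x powr q) + (1 - \<alpha>) * (1 / N))"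
    using assms \<alpha> by (intro sum_mono weighted_Young) auto
  also have "\<dots> = \<alpha> * (\<Sum>x\<in>S. f x powr q) + (1 - \<alpha>) * (real (card S) / N)"
    by (simp add: sum.distrib sum_distrib_left)
  also have "\<dots> \<le> \<alpha> * 1 + (1 - \<alpha>) * 1"
    using assms \<alpha> by (intro add_mono mult_left_mono) auto
  finally have "(\<Sum>x\<in>S. f x powr p) * N powr (- (1 - \<alpha>)) \<le> 1" by simp
  then show ?thesis using assms unfolding \<alpha>_def
    by (simp add: powr_minus_divide pos_divide_le_eq del: minus_diff_eq)
qed

lemma sum_powr_mono_exponent:
  fixes f :: "'b \<Rightarrow> real"
  assumes "finite S" "\<And>x. x \<in> S \<Longrightarrow> 0 \<le> f x" "0 < p" "p \<le> q"
    and "(\<Sum>x\<in>S. f x powr p) \<le> 1"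
  shows "(\<Sum>x\<in>S. f x powr q) \<le> 1"
proof -
  have "f x powr q \<le> f x powr p" if "x \<in> S" for x
  proof -
    have "f x powr p \<le> (\<Sum>x\<in>S. f x powr p)" using that assms by (intro member_le_sum) auto
    then have "f x powr p \<le> 1" using assms by simp
    then have "f x \<le> 1" using assms that powr_le_one_le gr_one_powr[of "f x" p]
      by (meson linorder_not_less)
    then show ?thesis using assms that by (intro powr_mono') auto
  qed
  then have "(\<Sum>x\<in>S. f x powr q) \<le> (\<Sum>x\<in>S. f x powr p)" by (rule sum_mono)
  then show ?thesis using assms by simp
qed

text \<open>Converse of Hoelder's inequality: since 1/\<kappa> = 1/\<mu> + 1/p, testing
  \<open>b\<close> against all weights in the unit ball of exponent p recovers its sum of \<mu>-th
  powers. \<open>1 \<le> C\<close> covers the case where that sum is at most 1, in particular 0,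
  where no extremal weight can be normalised.\<close>

lemma dual_sum_powr_bound:
  fixes b :: "'b \<Rightarrow> real"
  assumes "finite V" "\<And>v. v \<in> V \<Longrightarrow> 0 \<le> b v" "0 < \<kappa>" "\<kappa> < p" "1 / \<mu> = 1 / \<kappa> - 1 / p" "1 \<le> C"
    and bound: "\<And>w. (\<And>v. 0 \<le> w v) \<Longrightarrow> (\<Sum>v\<in>V. w v powr p) \<le> 1 \<Longrightarrow> (\<Sum>v\<in>V. (b v * w v) powr \<kappa>) \<le> C"
  shows "(\<Sum>v\<in>V. b v powr \<mu>) \<le> C powr (p / (p - \<kappa>))"
proof -
  define S where "S = (\<Sum>v\<in>V. b v powr \<mu>)"
  have "1 / \<mu> = (p - \<kappa>) / (\<kappa> * p)" using assms by (simp add: field_simps)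
  then have "1 / (1 / \<mu>) = \<kappa> * p / (p - \<kappa>)" by simp
  then have mu: "\<mu> = \<kappa> * p / (p - \<kappa>)" by simp
  have mu0: "\<mu> > 0" unfolding mu using assms by auto
  have ex: "\<mu> / p * \<kappa> + \<kappa> = \<mu>" unfolding mu using assms by (auto simp: field_simps)
  show ?thesis
  proof (cases "S \<le> 1")
    case True
    have "1 \<le> C powr (p / (p - \<kappa>))" using assms by (intro ge_one_powr_ge_zero) auto
    then show ?thesis using True unfolding S_def by simp
  next
    case False
    then have S1: "S > 0" by simp
    \<comment> \<open>The extremal weight in the duality between \<open>\<ell>\<^sub>\<mu>\<close> and \<open>\<ell>\<^sub>p\<close>.\<close>
    define w where "w v = (if v \<in> V then b v powr (\<mu> / p) / S powr (1 / p) else 0)" for v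
    have "(\<Sum>v\<in>V. w v powr p) = (\<Sum>v\<in>V. b v powr \<mu> / S)"
      unfolding w_def using assms S1 by (intro sum.cong) (auto simp: powr_divide powr_powr)
    also have "\<dots> = 1" using S1 by (simp add: S_def flip: sum_divide_distrib)
    finally have "(\<Sum>v\<in>V. (b v * w v) powr \<kappa>) \<le> C"
      using assms by (intro bound) (auto simp: w_def)
    also have "(\<Sum>v\<in>V. (b v * w v) powr \<kappa>) = (\<Sum>v\<in>V. b v powr \<mu> / S powr (\<kappa> / p))"
    proof (intro sum.cong refl)
      fix v assume v: "v \<in> V"
      have "(b v * w v) powr \<kappa> = b v powr \<kappa> * b v powr (\<mu> / p * \<kappa>) / S powr (\<kappa> / p)"
        unfolding w_def using assms v S1 by (simp add: powr_mult powr_divide powr_powr)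
      also have "b v powr \<kappa> * b v powr (\<mu> / p * \<kappa>) = b v powr \<mu>"
        unfolding powr_add[symmetric] using ex by (simp add: add.commute)
      finally show "(b v * w v) powr \<kappa> = b v powr \<mu> / S powr (\<kappa> / p)" .
    qed
    also have "\<dots> = S powr 1 / S powr (\<kappa> / p)" using S1 by (simp add: S_def sum_divide_distrib)
    also have "\<dots> = S powr (1 - \<kappa> / p)" by (rule powr_diff[symmetric])
    finally have "S powr (1 - \<kappa> / p) \<le> C" .
    then have "(S powr (1 - \<kappa> / p)) powr (p / (p - \<kappa>)) \<le> C powr (p / (p - \<kappa>))"
      using assms by (intro powr_mono2) auto
    moreover have "(1 - \<kappa> / p) * (p / (p - \<kappa>)) = 1" using assms by (simp add: field_simps)
    ultimately have "S powr 1 \<le> C powr (p / (p - \<kappa>))" unfolding powr_powr by (simp only:)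
    then show ?thesis using S1 by (simp add: S_def)
  qed
qed

text \<open>Columns are already controlled at exponent \<mu>, rows only at \<kappa> and with a
  weight inside the inner sum. The weight is taken to be a power of the column sums
  \<open>c v\<close>. Each row sum is then interpolated by Hoelder between the weighted sum
  \<open>X l\<close>, which \<open>bound\<close> controls, and \<open>Y l\<close>, whose total over
  all rows collapses to the quantity in \<open>col\<close>.\<close>

lemma transposed_sum_powr_bound:
  fixes A :: "'b \<Rightarrow> 'c \<Rightarrow> real"
  assumes fin: "finite L" "finite V" and A0: "\<And>l v. 0 \<le> A l v"
    and lam: "0 < \<kappa>" "\<kappa> < \<mu>" "\<mu> < 2" "0 < p" "1 / \<mu> = 1 / \<kappa> - 1 / p" and C': "1 \<le> C'"
    and col: "(\<Sum>v\<in>V. (\<Sum>l\<in>L. A l v) powr (\<mu> / 2)) \<le> C'"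
    and bound: "\<And>w. (\<And>v. 0 \<le> w v) \<Longrightarrow> (\<Sum>v\<in>V. w v powr p) \<le> 1 \<Longrightarrow>
      (\<Sum>l\<in>L. (\<Sum>v\<in>V. A l v * (w v)\<^sup>2) powr (\<kappa> / 2)) \<le> C"
  shows "(\<Sum>l\<in>L. (\<Sum>v\<in>V. A l v) powr (\<mu> / 2)) \<le> C * C' powr (\<kappa> / p) + C'"
proof -
  define c where "c v = (\<Sum>l\<in>L. A l v)" for v
  have c0: "0 \<le> c v" for v unfolding c_def using A0 by (simp add: sum_nonneg)
  have Ac: "A l v = 0" if "c v = 0" "l \<in> L" for l v
    using that sum_nonneg_eq_0_iff[of L "\<lambda>l. A l v"] fin A0 unfolding c_def by auto
  define X Y where "X l = (\<Sum>v\<in>V. A l v * c v powr (\<mu> / p))"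
    and "Y l = (\<Sum>v\<in>V. A l v * c v powr (\<mu> / 2 - 1))" for l
  have XY0: "0 \<le> X l" "0 \<le> Y l" for l unfolding X_def Y_def using A0 by (auto intro!: sum_nonneg)
  have pinv: "1 / p = 1 / \<kappa> - 1 / \<mu>" using lam by simp
  \<comment> \<open>\<open>\<theta>\<close> makes the powers of \<open>c v\<close> cancel in the interpolation of a row sum between \<open>X l\<close> and \<open>Y l\<close>;
    it then also turns Young's inequality into \<open>X l powr (\<kappa> / 2) + Y l\<close>.\<close>
  define \<theta> where "\<theta> = (1 / \<mu> - 1 / 2) / (1 / \<kappa> - 1 / 2)"
  have lt: "1 / \<mu> > 1 / 2" "1 / \<kappa> > 1 / \<mu>" using lam by (auto simp: field_simps)
  have th: "0 < \<theta>" "\<theta> < 1" unfolding \<theta>_def using lt by auto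
  have thmu: "\<theta> * (1 / \<kappa> - 1 / 2) = 1 / \<mu> - 1 / 2" unfolding \<theta>_def using lt by auto
  have eq1: "\<mu> / p * \<theta> + (\<mu> / 2 - 1) * (1 - \<theta>) = 0"
  proof -
    have "\<mu> / p * \<theta> + (\<mu> / 2 - 1) * (1 - \<theta>) = \<mu> * (1 / p * \<theta> + (1 / 2 - 1 / \<mu>) * (1 - \<theta>))"
      using lam by (simp add: field_simps)
    also have "1 / p * \<theta> + (1 / 2 - 1 / \<mu>) * (1 - \<theta>) = \<theta> * (1 / \<kappa> - 1 / 2) - (1 / \<mu> - 1 / 2)"
      unfolding pinv by (simp add: algebra_simps diff_divide_distrib add_divide_distrib)
    finally show ?thesis using thmu by simp
  qed
  define \<alpha> where "\<alpha> = \<theta> * \<mu> / \<kappa>"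
  have eq2: "(1 - \<theta>) * (\<mu> / 2) = 1 - \<alpha>"
  proof -
    have "(1 - \<theta>) * (\<mu> / 2) + \<alpha> = \<mu> * (\<theta> * (1 / \<kappa> - 1 / 2) + 1 / 2)"
      unfolding \<alpha>_def by (simp add: field_simps)
    also have "\<theta> * (1 / \<kappa> - 1 / 2) + 1 / 2 = 1 / \<mu>" using thmu by linarith
    also have "\<mu> * (1 / \<mu>) = 1" using lam(1,2) by simp
    finally show ?thesis by simp
  qed
  have al0: "0 < \<alpha>" unfolding \<alpha>_def using th lam by simp
  have "(1 - \<theta>) * (\<mu> / 2) > 0" using th lam by simp
  then have al1: "\<alpha> < 1" using eq2 by simp
  have Yeq: "(\<Sum>l\<in>L. Y l) = (\<Sum>v\<in>V. c v powr (\<mu> / 2))"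
  proof -
    have "(\<Sum>l\<in>L. Y l) = (\<Sum>v\<in>V. c v * c v powr (\<mu> / 2 - 1))"
      unfolding Y_def by (subst sum.swap) (simp add: c_def sum_distrib_right)
    also have "\<dots> = (\<Sum>v\<in>V. c v powr (\<mu> / 2))"
      using c0 by (intro sum.cong refl) (auto simp: powr_mult_base)
    finally show ?thesis .
  qed
  have row: "(\<Sum>v\<in>V. A l v) powr (\<mu> / 2) \<le> X l powr (\<kappa> / 2) + Y l" if l: "l \<in> L" for l
  proof -
    have "(\<Sum>v\<in>V. A l v) =
      (\<Sum>v\<in>V. (A l v * c v powr (\<mu> / p)) powr \<theta> * (A l v * c v powr (\<mu> / 2 - 1)) powr (1 - \<theta>))"
    proof (intro sum.cong refl)
      fix v
      show "A l v = (A l v * c v powr (\<mu> / p)) powr \<theta> * (A l v * c v powr (\<mu> / 2 - 1)) powr (1 - \<theta>)"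
      \<comment> \<open>In a zero column the powers of \<open>c v\<close> do not cancel to 1, but
        all entries of the column vanish.\<close>
      proof (cases "c v = 0")
        case True
        then show ?thesis using Ac l by simp
      next
        case False
        have "(A l v * c v powr (\<mu> / p)) powr \<theta> * (A l v * c v powr (\<mu> / 2 - 1)) powr (1 - \<theta>)
          = (A l v powr \<theta> * A l v powr (1 - \<theta>)) * (c v powr (\<mu> / p * \<theta>) * c v powr ((\<mu> / 2 - 1) * (1 - \<theta>)))"
          using A0 by (simp add: powr_mult powr_powr mult_ac)
        also have "\<dots> = A l v powr 1 * c v powr 0"
          unfolding powr_add[symmetric] eq1 by simp
        also have "\<dots> = A l v" using False A0 by simp
        finally show ?thesis by simp
      qed
    qed
    also have "\<dots> \<le> X l powr \<theta> * Y l powr (1 - \<theta>)"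
      unfolding X_def Y_def using fin A0 th by (intro Holder_sum_powr) auto
    finally have "(\<Sum>v\<in>V. A l v) powr (\<mu> / 2) \<le> (X l powr \<theta> * Y l powr (1 - \<theta>)) powr (\<mu> / 2)"
      using A0 lam by (intro powr_mono2) (auto intro: sum_nonneg)
    also have "\<dots> = (X l powr (\<kappa> / 2)) powr \<alpha> * Y l powr (1 - \<alpha>)"
      unfolding eq2[symmetric] using lam by (simp add: powr_mult powr_powr \<alpha>_def)
    also have "\<dots> \<le> X l powr (\<kappa> / 2) + Y l"
      using XY0 al0 al1 by (intro weighted_Young_le_add) auto
    finally show ?thesis .
  qed
  \<comment> \<open>\<open>w v powr p\<close> equals \<open>c v powr (\<mu> / 2) / C'\<close>, so
    \<open>col\<close> puts \<open>w\<close> in the unit ball; its square is the weight in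
    \<open>X l\<close> up to a constant factor.\<close>
  define w where "w v = c v powr (\<mu> / (2 * p)) / C' powr (1 / p)" for v
  have w2: "(w v)\<^sup>2 = c v powr (\<mu> / p) * C' powr (- 2 / p)" for v
  proof -
    have "(w v)\<^sup>2 = w v powr 2" using C' c0 by (subst powr_numeral) (auto simp: w_def)
    then show ?thesis unfolding w_def using C' c0 lam
      by (simp add: powr_divide powr_powr powr_minus_divide)
  qed
  have "(\<Sum>v\<in>V. w v powr p) = (\<Sum>v\<in>V. c v powr (\<mu> / 2)) / C'"
    unfolding w_def sum_divide_distrib using C' lam
    by (intro sum.cong) (auto simp: powr_divide powr_powr)
  also have "\<dots> \<le> 1" using col C' unfolding c_def by simp
  finally have "(\<Sum>l\<in>L. (\<Sum>v\<in>V. A l v * (w v)\<^sup>2) powr (\<kappa> / 2)) \<le> C"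
    by (intro bound) (auto simp: w_def)
  also have "(\<Sum>l\<in>L. (\<Sum>v\<in>V. A l v * (w v)\<^sup>2) powr (\<kappa> / 2)) = (\<Sum>l\<in>L. X l powr (\<kappa> / 2)) * C' powr (- \<kappa> / p)"
    unfolding sum_distrib_right
  proof (intro sum.cong refl)
    fix l
    have "(\<Sum>v\<in>V. A l v * (w v)\<^sup>2) = X l * C' powr (- 2 / p)"
      unfolding w2 X_def sum_distrib_right by (simp add: mult_ac)
    then show "(\<Sum>v\<in>V. A l v * (w v)\<^sup>2) powr (\<kappa> / 2) = X l powr (\<kappa> / 2) * C' powr (- \<kappa> / p)"
      using XY0 by (simp add: powr_mult powr_powr)
  qed
  finally have Xb: "(\<Sum>l\<in>L. X l powr (\<kappa> / 2)) \<le> C * C' powr (\<kappa> / p)"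
    using C' by (simp add: powr_minus_divide pos_divide_le_eq)
  have "(\<Sum>l\<in>L. (\<Sum>v\<in>V. A l v) powr (\<mu> / 2)) \<le> (\<Sum>l\<in>L. X l powr (\<kappa> / 2) + Y l)"
    using row by (rule sum_mono)
  also have "\<dots> \<le> C * C' powr (\<kappa> / p) + C'"
    unfolding sum.distrib using Xb col Yeq unfolding c_def by simp
  finally show ?thesis .
qed

text \<open>A crude arithmetic-geometric mean inequality: every factor is at most the corresponding
  root of the whole sum.\<close>

lemma prod_root_le_sum:
  fixes a :: "'b \<Rightarrow> real"
  assumes "finite S" "S \<noteq> {}" "\<And>k. k \<in> S \<Longrightarrow> 0 \<le> a k"
  shows "(\<Prod>k\<in>S. a k powr (1 / card S)) \<le> sum a S"
proof -
  have c: "card S > 0" using assms by (simp add: card_gt_0_iff)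
  have "(\<Prod>k\<in>S. a k powr (1 / card S)) \<le> (\<Prod>k\<in>S. sum a S powr (1 / card S))"
    using assms by (intro prod_mono conjI powr_mono2 member_le_sum) auto
  also have "\<dots> = sum a S powr (real (card S) * (1 / card S))"
  proof (cases "sum a S = 0")
    case True
    then show ?thesis using c by simp
  next
    case False
    then have "sum a S > 0" using assms sum_nonneg[of S a] by simp
    then show ?thesis using c by (simp add: powr_powr flip: powr_realpow)
  qed
  also have "\<dots> = sum a S" using c assms sum_nonneg[of S a] by simp
  finally show ?thesis .
qed

text \<open>In place of iterated Hoelder and Minkowski inequalities, one pointwise Young inequality:
  \<open>A j powr (q / 2)\<close> is at most \<open>A j * P + Q\<close>. Here \<open>P\<close> is a
  geometric mean of the \<open>R k (j k) powr (\<kappa> / 2 - 1)\<close>, hence at most their sum,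
  and summing \<open>A j\<close> over the slice \<open>j k = l\<close> turns each term into
  \<open>R k l powr (\<kappa> / 2)\<close>; this yields \<open>m * C\<close>. \<open>Q\<close> is a
  product of functions of one index each, so its sum over \<open>j\<close> factors and yields
  \<open>C ^ m\<close>.\<close>

lemma Blei_interpolation:
  fixes A :: "(nat \<Rightarrow> nat) \<Rightarrow> real" and m n :: nat and C :: real
  defines "J \<equiv> {..<m} \<rightarrow>\<^sub>E {..<n}"
  defines "R \<equiv> \<lambda>k l. \<Sum>j\<in>{j\<in>J. j k = l}. A j"
  assumes m: "m > 0" and A0: "\<And>j. 0 \<le> A j" and lam: "1 \<le> \<kappa>" "\<kappa> < 2"
    and q: "1 / q = 1 / 2 + (1 / \<kappa> - 1 / 2) / m"
    and R: "\<And>k. k < m \<Longrightarrow> (\<Sum>l<n. R k l powr (\<kappa> / 2)) \<le> C"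
  shows "(\<Sum>j\<in>J. A j powr (q / 2)) \<le> m * C + C ^ m"
proof -
  have finJ: "finite J" unfolding J_def by (intro finite_PiE) auto
  have R0: "0 \<le> R k l" for k l unfolding R_def using A0 by (simp add: sum_nonneg)
  have AR: "A j \<le> R k (j k)" if "j \<in> J" for j k
    unfolding R_def using that finJ A0 by (intro member_le_sum) auto
  define d where "d = (1 / \<kappa> - 1 / 2) / m"
  have d: "d > 0" unfolding d_def using m lam by (simp add: field_simps)
  have qe: "q = 1 / (1 / 2 + d)" using q d unfolding d_def by (metis div_by_1 divide_divide_eq_right mult_1)
  have q2: "0 < q" "q < 2" unfolding qe using d by (auto simp: field_simps)
  define \<beta> where "\<beta> = (1 - \<kappa> / 2) / m"
  have bq: "\<beta> * (q / 2) = \<kappa> / 2 * (1 - q / 2)"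
  proof -
    have "\<beta> = \<kappa> * d" unfolding \<beta>_def d_def using lam m by (simp add: field_simps)
    then show ?thesis unfolding qe using d by (simp add: field_simps)
  qed
  have J: "j k < n" if "j \<in> J" "k < m" for j k using that unfolding J_def by auto
  have pt: "A j powr (q / 2) \<le> (\<Sum>k<m. A j * R k (j k) powr (\<kappa> / 2 - 1)) + (\<Prod>k<m. R k (j k) powr (\<kappa> / 2))"
    if j: "j \<in> J" for j
  proof (cases "A j = 0")
    case True
    then show ?thesis using R0 by (auto intro!: add_nonneg_nonneg sum_nonneg prod_nonneg)
  next
    case False
    then have Ap: "A j > 0" using A0[of j] by simp
    have Rp: "R k (j k) > 0" for k using AR[OF j, of k] Ap by simp
    have Rn: "R k (j k) \<noteq> 0" for k using Rp[of k] by simp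
    have e0: "- \<beta> * (q / 2) + \<kappa> / 2 * (1 - q / 2) = 0" using bq by simp
    \<comment> \<open>\<open>\<beta>\<close> is chosen so that \<open>P powr (q / 2)\<close> and \<open>Q powr (1 - q / 2)\<close> are inverse to each other.\<close>
    define P where "P = (\<Prod>k<m. R k (j k) powr (- \<beta>))"
    define Q where "Q = (\<Prod>k<m. R k (j k) powr (\<kappa> / 2))"
    have P0: "P > 0" unfolding P_def using Rn by (intro prod_pos) simp
    have "A j powr (q / 2) = (A j * P) powr (q / 2) * Q powr (1 - q / 2)"
    proof -
      have "P powr (q / 2) * Q powr (1 - q / 2)
        = (\<Prod>k<m. R k (j k) powr (- \<beta> * (q / 2)) * R k (j k) powr (\<kappa> / 2 * (1 - q / 2)))"
        unfolding P_def Q_def by (simp add: powr_powr prod.distrib prod_powr_distrib)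
      also have "\<dots> = 1"
        unfolding powr_add[symmetric] e0 by (simp add: Rn)
      finally show ?thesis using Ap P0 by (simp add: powr_mult)
    qed
    also have "\<dots> \<le> A j * P + Q"
      using Ap P0 q2 Rp unfolding Q_def by (intro weighted_Young_le_add prod_nonneg) (auto intro!: mult_nonneg_nonneg)
    also have "P \<le> (\<Sum>k<m. R k (j k) powr (\<kappa> / 2 - 1))"
    proof -
      have "P = (\<Prod>k<m. (R k (j k) powr (\<kappa> / 2 - 1)) powr (1 / card {..<m}))"
        unfolding P_def \<beta>_def by (simp add: powr_powr diff_divide_distrib)
      also have "\<dots> \<le> (\<Sum>k<m. R k (j k) powr (\<kappa> / 2 - 1))"
        using m by (intro prod_root_le_sum) auto
      finally show ?thesis .
    qed
    finally show ?thesis using Ap by (simp add: sum_distrib_left Q_def)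
  qed
  have s1: "(\<Sum>j\<in>J. \<Sum>k<m. A j * R k (j k) powr (\<kappa> / 2 - 1)) \<le> (\<Sum>k<m. C)"
  proof (subst sum.swap, rule sum_mono)
    fix k assume "k \<in> {..<m}"
    then have k: "k < m" by simp
    have "(\<Sum>j\<in>J. A j * R k (j k) powr (\<kappa> / 2 - 1))
      = (\<Sum>l<n. \<Sum>j\<in>{j\<in>J. j k = l}. A j * R k (j k) powr (\<kappa> / 2 - 1))"
      using finJ J k by (intro sum.group[symmetric]) auto
    also have "\<dots> = (\<Sum>l<n. R k l * R k l powr (\<kappa> / 2 - 1))"
      unfolding R_def by (simp add: sum_distrib_right)
    also have "\<dots> = (\<Sum>l<n. R k l powr (\<kappa> / 2))"
      using R0 by (simp add: powr_mult_base)
    finally show "(\<Sum>j\<in>J. A j * R k (j k) powr (\<kappa> / 2 - 1)) \<le> C" using R[OF k] by simp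
  qed
  have s2: "(\<Sum>j\<in>J. \<Prod>k<m. R k (j k) powr (\<kappa> / 2)) \<le> C ^ m"
  proof -
    have "(\<Sum>j\<in>J. \<Prod>k<m. R k (j k) powr (\<kappa> / 2)) = (\<Prod>k<m. \<Sum>l<n. R k l powr (\<kappa> / 2))"
      unfolding J_def by (intro prod_sum_PiE[symmetric]) auto
    also have "\<dots> \<le> (\<Prod>k<m. C)" using R by (intro prod_mono) (auto intro: sum_nonneg)
    finally show ?thesis by simp
  qed
  have "(\<Sum>j\<in>J. A j powr (q / 2)) \<le> (\<Sum>j\<in>J. (\<Sum>k<m. A j * R k (j k) powr (\<kappa> / 2 - 1)) + (\<Prod>k<m. R k (j k) powr (\<kappa> / 2)))"
    using pt by (rule sum_mono)
  then show ?thesis using s1 s2 unfolding sum.distrib by simp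
qed

subsection \<open>Arrays and Khinchin's inequality\<close>

abbreviation idx :: "nat \<Rightarrow> nat \<Rightarrow> (nat \<Rightarrow> nat) set" where
  "idx m n \<equiv> {..<m} \<rightarrow>\<^sub>E {..<n}"

definition array_form ::
  "nat \<Rightarrow> nat \<Rightarrow> ((nat \<Rightarrow> nat) \<Rightarrow> 'a::comm_semiring_1) \<Rightarrow> (nat \<Rightarrow> nat \<Rightarrow> 'a) \<Rightarrow> 'a" where
  "array_form m n t x = (\<Sum>j\<in>idx m n. t j * (\<Prod>i<m. x i (j i)))"

definition slice_sq :: "nat \<Rightarrow> nat \<Rightarrow> ((nat \<Rightarrow> nat) \<Rightarrow> real) \<Rightarrow> nat \<Rightarrow> nat \<Rightarrow> real" where
  "slice_sq m n t i l = (\<Sum>j\<in>{j\<in>idx m n. j i = l}. (t j)\<^sup>2)"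

lemma finite_idx: "finite (idx m n)"
  by (intro finite_PiE) auto

lemma sum_PiE_insert:
  assumes "x \<notin> S"
  shows "(\<Sum>g\<in>PiE (insert x S) B. h g) = (\<Sum>y\<in>B x. \<Sum>g\<in>PiE S B. h (g(x := y)))"
proof -
  have "(\<Sum>g\<in>PiE (insert x S) B. h g) = (\<Sum>z\<in>B x \<times> PiE S B. h ((\<lambda>(y, g). g(x := y)) z))"
    unfolding PiE_insert_eq using assms inj_combinator[of x S B] by (subst sum.reindex) auto
  then show ?thesis by (simp add: sum.cartesian_product case_prod_unfold)
qed

lemma sum_idx_split:
  assumes "i < m"
  shows "(\<Sum>j\<in>idx m n. h j) = (\<Sum>l<n. \<Sum>j\<in>({..<m} - {i}) \<rightarrow>\<^sub>E {..<n}. h (j(i := l)))"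
proof -
  have "{..<m} = insert i ({..<m} - {i})" using assms by auto
  then show ?thesis using sum_PiE_insert[of i "{..<m} - {i}" h "\<lambda>_. {..<n}"] by simp
qed

lemma array_form_split:
  assumes "i < m"
  shows "array_form m n t x = (\<Sum>l<n. x i l *
    (\<Sum>j\<in>({..<m} - {i}) \<rightarrow>\<^sub>E {..<n}. t (j(i := l)) * (\<Prod>k\<in>{..<m} - {i}. x k (j k))))"
proof -
  have "(\<Prod>k<m. x k ((j(i := l)) k)) = x i l * (\<Prod>k\<in>{..<m} - {i}. x k (j k))" for j :: "nat \<Rightarrow> nat" and l
    using assms by (subst prod.remove[of _ i]) auto
  then show ?thesis unfolding array_form_def sum_idx_split[OF assms]
    by (simp add: sum_distrib_left mult_ac)
qed

lemma slice_sq_split: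
  assumes "i < m" "l < n"
  shows "slice_sq m n t i l = (\<Sum>j\<in>({..<m} - {i}) \<rightarrow>\<^sub>E {..<n}. (t (j(i := l)))\<^sup>2)"
proof -
  have "slice_sq m n t i l = (\<Sum>j\<in>idx m n. if j i = l then (t j)\<^sup>2 else 0)"
    unfolding slice_sq_def using finite_idx by (intro sum.inter_filter) auto
  also have "\<dots> = (\<Sum>y<n. \<Sum>j\<in>({..<m} - {i}) \<rightarrow>\<^sub>E {..<n}. if y = l then (t (j(i := y)))\<^sup>2 else 0)"
    unfolding sum_idx_split[OF assms(1)] by simp
  also have "\<dots> = (\<Sum>y<n. if y = l then (\<Sum>j\<in>({..<m} - {i}) \<rightarrow>\<^sub>E {..<n}. (t (j(i := y)))\<^sup>2) else 0)"
    by (intro sum.cong) auto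
  also have "\<dots> = (\<Sum>j\<in>({..<m} - {i}) \<rightarrow>\<^sub>E {..<n}. (t (j(i := l)))\<^sup>2)"
    using assms by simp
  finally show ?thesis .
qed

section \<open>Rademacher sums and their moments\<close>

definition signs :: "'b set \<Rightarrow> ('b \<Rightarrow> real) set" where
  "signs L = L \<rightarrow>\<^sub>E {-1, 1}"

lemma sum_signs_insert:
  assumes "x \<notin> S"
  shows "(\<Sum>g\<in>signs (insert x S). h g) = (\<Sum>g\<in>signs S. h (g(x := -1)) + h (g(x := 1)))"
  unfolding signs_def sum_PiE_insert[OF assms] by (simp add: sum.distrib)

lemma finite_signs: "finite L \<Longrightarrow> finite (signs L)"
  unfolding signs_def by (intro finite_PiE) auto

lemma card_signs: "finite L \<Longrightarrow> card (signs L) = 2 ^ card L"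
  unfolding signs_def by (simp add: card_PiE numeral_2_eq_2)

lemma sum_signs_linear:
  fixes a :: "'b \<Rightarrow> real"
  assumes "x \<notin> S" "finite S"
  shows "(\<Sum>l\<in>insert x S. (g(x := y)) l * a l) = y * a x + (\<Sum>l\<in>S. g l * a l)"
proof -
  have "(\<Sum>l\<in>S. (g(x := y)) l * a l) = (\<Sum>l\<in>S. g l * a l)"
    using assms by (intro sum.cong) auto
  then show ?thesis using assms by simp
qed

lemma Rademacher_second_moment:
  assumes "finite L"
  shows "(\<Sum>g\<in>signs L. (\<Sum>l\<in>L. g l * a l)\<^sup>2) = 2 ^ card L * (\<Sum>l\<in>L. (a l)\<^sup>2)"
  using assms
proof (induction L rule: finite_induct)
  case empty
  then show ?case by (simp add: signs_def)
next
  case (insert x S)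
  have "(\<Sum>g\<in>signs (insert x S). (\<Sum>l\<in>insert x S. g l * a l)\<^sup>2)
     = (\<Sum>g\<in>signs S. 2 * (\<Sum>l\<in>S. g l * a l)\<^sup>2 + 2 * (a x)\<^sup>2)"
    unfolding sum_signs_insert[OF insert(2)] sum_signs_linear[OF insert(2,1)]
    by (intro sum.cong) (auto simp: power2_eq_square algebra_simps)
  also have "\<dots> = 2 * (\<Sum>g\<in>signs S. (\<Sum>l\<in>S. g l * a l)\<^sup>2) + 2 ^ card S * (2 * (a x)\<^sup>2)"
    using insert(1) by (simp add: sum.distrib sum_distrib_left card_signs)
  finally show ?case using insert by (simp add: algebra_simps)
qed

text \<open>Averaging over the last sign removes the odd powers and leaves s^4 + 6 u^2 s^2 + u^4.
  The constant 3 makes the cross term 6 u^2 B match that of 3 (u^2 + B)^2, and u^4 \<le> 3 u^4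
  closes the induction.\<close>

lemma Rademacher_fourth_moment:
  assumes "finite L"
  shows "(\<Sum>g\<in>signs L. (\<Sum>l\<in>L. g l * a l) ^ 4) \<le> 2 ^ card L * (3 * (\<Sum>l\<in>L. (a l)\<^sup>2)\<^sup>2)"
  using assms
proof (induction L rule: finite_induct)
  case empty
  then show ?case by (simp add: signs_def)
next
  case (insert x S)
  define B where "B = (\<Sum>l\<in>S. (a l)\<^sup>2)"
  have eq: "(-1 * u + s) ^ 4 + (1 * u + s) ^ 4 = 2 * s ^ 4 + 12 * u\<^sup>2 * s\<^sup>2 + 2 * u ^ 4" for u s :: real
    by (simp add: power2_eq_square power4_eq_xxxx algebra_simps)
  have "(\<Sum>g\<in>signs (insert x S). (\<Sum>l\<in>insert x S. g l * a l) ^ 4)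
     = (\<Sum>g\<in>signs S. 2 * (\<Sum>l\<in>S. g l * a l) ^ 4 + 12 * (a x)\<^sup>2 * (\<Sum>l\<in>S. g l * a l)\<^sup>2 + 2 * (a x) ^ 4)"
    unfolding sum_signs_insert[OF insert(2)] sum_signs_linear[OF insert(2,1)] eq by simp
  also have "\<dots> = 2 * (\<Sum>g\<in>signs S. (\<Sum>l\<in>S. g l * a l) ^ 4)
      + 12 * (a x)\<^sup>2 * (\<Sum>g\<in>signs S. (\<Sum>l\<in>S. g l * a l)\<^sup>2) + 2 ^ card S * (2 * (a x) ^ 4)"
    using insert(1) by (simp add: sum.distrib sum_distrib_left card_signs)
  also have "\<dots> \<le> 2 * (2 ^ card S * (3 * B\<^sup>2)) + 12 * (a x)\<^sup>2 * (2 ^ card S * B) + 2 ^ card S * (2 * (a x) ^ 4)"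
    using insert unfolding B_def by (simp add: Rademacher_second_moment)
  also have "\<dots> \<le> 2 * (2 ^ card S * (3 * B\<^sup>2)) + 12 * (a x)\<^sup>2 * (2 ^ card S * B) + 2 ^ card S * (6 * (a x) ^ 4)"
    by (intro add_mono mult_left_mono mult_right_mono) auto
  also have "\<dots> = 2 ^ card (insert x S) * (3 * ((a x)\<^sup>2 + B)\<^sup>2)"
    using insert by (simp add: power2_eq_square power4_eq_xxxx algebra_simps)
  finally show ?case using insert by (simp add: B_def)
qed

lemma Khinchin_L1:
  assumes L: "finite L"
  shows "2 ^ card L * L2_set a L \<le> 2 * (\<Sum>g\<in>signs L. \<bar>\<Sum>l\<in>L. g l * a l\<bar>)"
proof (cases "L2_set a L = 0")
  case True
  then show ?thesis by (simp add: sum_nonneg)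
next
  case False
  define b where "b = L2_set a L"
  have b: "b > 0" using False L2_set_nonneg[of a L] unfolding b_def by linarith
  have b2: "b\<^sup>2 = (\<Sum>l\<in>L. (a l)\<^sup>2)" unfolding b_def L2_set_def by (simp add: sum_nonneg)
  \<comment> \<open>\<open>16 u - 12 u\<^sup>2 + u\<^sup>4 = u (u - 2)\<^sup>2 (u + 4)\<close> turns the second and fourth moments into a first one.\<close>
  have pt: "16 * b ^ 3 * \<bar>y\<bar> \<ge> 12 * b\<^sup>2 * y\<^sup>2 - y ^ 4" for y
  proof -
    define z where "z = \<bar>y\<bar>"
    have "16 * b ^ 3 * z - 12 * b\<^sup>2 * z\<^sup>2 + z ^ 4 = z * (z - 2 * b)\<^sup>2 * (z + 4 * b)"
      by (simp add: power2_eq_square power4_eq_xxxx power3_eq_cube algebra_simps)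
    also have "\<dots> \<ge> 0" using b unfolding z_def by simp
    finally show ?thesis unfolding z_def by simp
  qed
  \<comment> \<open>The two moments leave 12 - 3 = 9; weakening this to 8 produces the constant 2 of
    the statement.\<close>
  have "8 * b ^ 3 * (2 ^ card L * b) \<le> 2 ^ card L * (12 * b\<^sup>2 * b\<^sup>2 - 3 * (b\<^sup>2)\<^sup>2)"
    using b by (simp add: power2_eq_square power3_eq_cube)
  also have "\<dots> \<le> 12 * b\<^sup>2 * (\<Sum>g\<in>signs L. (\<Sum>l\<in>L. g l * a l)\<^sup>2) - (\<Sum>g\<in>signs L. (\<Sum>l\<in>L. g l * a l) ^ 4)"
    using Rademacher_fourth_moment[OF L, of a] unfolding Rademacher_second_moment[OF L] b2[symmetric]
    by (simp add: algebra_simps)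
  also have "\<dots> = (\<Sum>g\<in>signs L. 12 * b\<^sup>2 * (\<Sum>l\<in>L. g l * a l)\<^sup>2 - (\<Sum>l\<in>L. g l * a l) ^ 4)"
    by (simp add: sum_subtractf sum_distrib_left)
  also have "\<dots> \<le> (\<Sum>g\<in>signs L. 16 * b ^ 3 * \<bar>\<Sum>l\<in>L. g l * a l\<bar>)"
    by (intro sum_mono pt)
  also have "\<dots> = 8 * b ^ 3 * (2 * (\<Sum>g\<in>signs L. \<bar>\<Sum>l\<in>L. g l * a l\<bar>))"
    by (simp add: sum_distrib_left mult.assoc)
  finally show ?thesis using b unfolding b_def[symmetric] by (simp add: mult.commute)
qed

lemma L2_set_sum_le: "finite S \<Longrightarrow> L2_set (\<lambda>y. \<Sum>e\<in>S. G e y) Y \<le> (\<Sum>e\<in>S. L2_set (G e) Y)"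
proof (induction S rule: finite_induct)
  case empty
  then show ?case by (simp add: L2_set_def)
next
  case (insert x S)
  then show ?case using L2_set_triangle_ineq[of "G x" "\<lambda>y. \<Sum>e\<in>S. G e y" Y] by simp
qed

text \<open>The induction hypothesis is applied to each slice \<open>j x = y\<close>. Minkowski's
  inequality moves the sum over the old signs out of the \<open>L2_set\<close> over
  \<open>y\<close>, and for each choice of old signs \<open>Khinchin_L1\<close> treats the new
  variable.\<close>

lemma Khinchin_L1_multilinear:
  fixes S :: "nat set"
  assumes "finite S"
  shows "2 ^ (n * card S) * sqrt (\<Sum>j\<in>S \<rightarrow>\<^sub>E {..<n}. (a j)\<^sup>2) \<le>
    2 ^ card S * (\<Sum>e\<in>S \<rightarrow>\<^sub>E signs {..<n}. \<bar>\<Sum>j\<in>S \<rightarrow>\<^sub>E {..<n}. a j * (\<Prod>k\<in>S. e k (j k))\<bar>)"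
  using assms
proof (induction S arbitrary: a rule: finite_induct)
  case empty
  then show ?case by simp
next
  case (insert x S)
  let ?E = "S \<rightarrow>\<^sub>E signs {..<n}" and ?J = "S \<rightarrow>\<^sub>E {..<n}"
  have finE: "finite ?E" using insert by (intro finite_PiE finite_signs) auto
  define G where "G y e = (\<Sum>j\<in>?J. a (j(x := y)) * (\<Prod>k\<in>S. e k (j k)))" for y and e :: "nat \<Rightarrow> nat \<Rightarrow> real"
  define N where "N y = sqrt (\<Sum>j\<in>?J. (a (j(x := y)))\<^sup>2)" for y
  have prod_eq: "(\<Prod>k\<in>insert x S. (e(x := d)) k ((j(x := y)) k)) = d y * (\<Prod>k\<in>S. e k (j k))"
    for e :: "nat \<Rightarrow> nat \<Rightarrow> real" and d j y
  proof -
    have "(\<Prod>k\<in>S. (e(x := d)) k ((j(x := y)) k)) = (\<Prod>k\<in>S. e k (j k))"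
      using insert by (intro prod.cong) auto
    then show ?thesis using insert by simp
  qed
  have full: "(\<Sum>j\<in>insert x S \<rightarrow>\<^sub>E {..<n}. a j * (\<Prod>k\<in>insert x S. (e(x := d)) k (j k)))
      = (\<Sum>y<n. d y * G y e)" for e d
    unfolding sum_PiE_insert[OF insert(2)] prod_eq G_def by (simp add: sum_distrib_left mult_ac)
  have "sqrt (\<Sum>j\<in>insert x S \<rightarrow>\<^sub>E {..<n}. (a j)\<^sup>2) = L2_set N {..<n}"
    unfolding sum_PiE_insert[OF insert(2)] L2_set_def N_def by (simp add: sum_nonneg)
  then have "2 ^ (n * card (insert x S)) * sqrt (\<Sum>j\<in>insert x S \<rightarrow>\<^sub>E {..<n}. (a j)\<^sup>2)
      = 2 ^ n * (2 ^ (n * card S) * L2_set N {..<n})"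
    using insert by (simp add: power_add)
  also have "2 ^ (n * card S) * L2_set N {..<n} = L2_set (\<lambda>y. 2 ^ (n * card S) * N y) {..<n}"
    by (simp add: L2_set_right_distrib)
  also have "\<dots> \<le> L2_set (\<lambda>y. \<Sum>e\<in>?E. 2 ^ card S * \<bar>G y e\<bar>) {..<n}"
    using insert(3)[of "\<lambda>j. a (j(x := _))"] unfolding N_def G_def
    by (intro L2_set_mono) (auto simp: sum_distrib_left intro!: sum_nonneg mult_nonneg_nonneg)
  also have "\<dots> \<le> (\<Sum>e\<in>?E. L2_set (\<lambda>y. 2 ^ card S * \<bar>G y e\<bar>) {..<n})"
    by (rule L2_set_sum_le[OF finE])
  also have "\<dots> = 2 ^ card S * (\<Sum>e\<in>?E. L2_set (\<lambda>y. G y e) {..<n})"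
    by (simp add: sum_distrib_left flip: L2_set_right_distrib) (simp add: L2_set_def)
  also have "2 ^ n * (2 ^ card S * (\<Sum>e\<in>?E. L2_set (\<lambda>y. G y e) {..<n}))
      = 2 ^ card S * (\<Sum>e\<in>?E. 2 ^ card {..<n} * L2_set (\<lambda>y. G y e) {..<n})"
    by (simp add: sum_distrib_left mult_ac)
  also have "\<dots> \<le> 2 ^ card S * (\<Sum>e\<in>?E. 2 * (\<Sum>d\<in>signs {..<n}. \<bar>\<Sum>y<n. d y * G y e\<bar>))"
    by (intro mult_left_mono sum_mono Khinchin_L1) auto
  also have "\<dots> = 2 ^ card (insert x S) * (\<Sum>e\<in>?E. \<Sum>d\<in>signs {..<n}. \<bar>\<Sum>y<n. d y * G y e\<bar>)"
    using insert(1,2) by (simp add: sum_distrib_left mult_ac)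
  also have "(\<Sum>e\<in>?E. \<Sum>d\<in>signs {..<n}. \<bar>\<Sum>y<n. d y * G y e\<bar>) =
     (\<Sum>e\<in>insert x S \<rightarrow>\<^sub>E signs {..<n}. \<bar>\<Sum>j\<in>insert x S \<rightarrow>\<^sub>E {..<n}. a j * (\<Prod>k\<in>insert x S. e k (j k))\<bar>)"
    unfolding sum_PiE_insert[OF insert(2), where B = "\<lambda>_. signs {..<n}"] full by (rule sum.swap)
  finally show ?case by (simp add: mult_left_mono)
qed

text \<open>The variables in \<open>U\<close> range over the \<open>\<ell>\<^sub>p\<close>-ball, the others over the sup-norm ball.\<close>
definition ball_bounded :: "nat \<Rightarrow> nat \<Rightarrow> real \<Rightarrow> nat set \<Rightarrow> ((nat \<Rightarrow> nat) \<Rightarrow> real) \<Rightarrow> bool" where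
  "ball_bounded m n p U t \<longleftrightarrow> (\<forall>x. (\<forall>i\<in>U. (\<Sum>l<n. \<bar>x i l\<bar> powr p) \<le> 1) \<longrightarrow>
     (\<forall>i\<in>{..<m} - U. \<forall>l<n. \<bar>x i l\<bar> \<le> 1) \<longrightarrow> \<bar>array_form m n t x\<bar> \<le> 1)"

text \<open>For fixed signs \<open>e\<close> in the other variables, inserting the signs of the
  coefficients \<open>G l e\<close> into variable \<open>i\<close> shows that their absolute values
  sum to at most 1. Summing over all \<open>e\<close> and applying Khinchin's inequality to each
  slice costs a factor 2 for each of the other m - 1 variables.\<close>

lemma mixed_Littlewood:
  assumes b: "ball_bounded m n p {} t" and i: "i < m"
  shows "(\<Sum>l<n. sqrt (slice_sq m n t i l)) \<le> 2 ^ (m - 1)"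
proof -
  define S where "S = {..<m} - {i}"
  have S: "finite S" "card S = m - 1" using i unfolding S_def by auto
  let ?E = "S \<rightarrow>\<^sub>E signs {..<n}" and ?J = "S \<rightarrow>\<^sub>E {..<n}"
  define G where "G l e = (\<Sum>j\<in>?J. t (j(i := l)) * (\<Prod>k\<in>S. e k (j k)))" for l and e :: "nat \<Rightarrow> nat \<Rightarrow> real"
  have one: "(\<Sum>l<n. \<bar>G l e\<bar>) \<le> 1" if e: "e \<in> ?E" for e
  proof -
    define x where "x = e(i := \<lambda>l. sgn (G l e))"
    have ek: "\<bar>e k l\<bar> \<le> 1" if "k \<in> S" "l < n" for k l
    proof -
      have "e k \<in> signs {..<n}" using e that by auto
      then have "e k l \<in> {-1, 1}" using that unfolding signs_def by auto
      then show ?thesis by auto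
    qed
    have "\<bar>array_form m n t x\<bar> \<le> 1"
      using b[unfolded ball_bounded_def, rule_format, of x] ek unfolding x_def S_def
      by (auto simp: sgn_real_def)
    also have "array_form m n t x = (\<Sum>l<n. x i l * G l x)"
      unfolding array_form_split[OF i] G_def S_def by simp
    also have "\<dots> = (\<Sum>l<n. \<bar>G l e\<bar>)"
    proof (intro sum.cong refl)
      fix l
      have "G l x = G l e" unfolding G_def x_def S_def by (intro sum.cong arg_cong2[where f = times] prod.cong) auto
      then show "x i l * G l x = \<bar>G l e\<bar>" unfolding x_def by (simp add: abs_sgn mult.commute)
    qed
    finally show ?thesis by simp
  qed
  have finE: "finite ?E" using S by (intro finite_PiE finite_signs) auto
  have "2 ^ (n * card S) * (\<Sum>l<n. sqrt (slice_sq m n t i l))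
    = (\<Sum>l<n. 2 ^ (n * card S) * sqrt (\<Sum>j\<in>?J. (t (j(i := l)))\<^sup>2))"
    unfolding sum_distrib_left S_def using i by (intro sum.cong) (auto simp: slice_sq_split)
  also have "\<dots> \<le> (\<Sum>l<n. 2 ^ card S * (\<Sum>e\<in>?E. \<bar>G l e\<bar>))"
    unfolding G_def by (intro sum_mono Khinchin_L1_multilinear S)
  also have "\<dots> = 2 ^ card S * (\<Sum>e\<in>?E. \<Sum>l<n. \<bar>G l e\<bar>)"
    by (subst sum.swap) (simp add: sum_distrib_left)
  also have "\<dots> \<le> 2 ^ card S * (\<Sum>e\<in>?E. 1)"
    by (intro mult_left_mono sum_mono one) auto
  also have "\<dots> = 2 ^ (n * card S) * 2 ^ card S"
    using S by (simp add: card_PiE card_signs power_mult)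
  finally show ?thesis unfolding S(2) by simp
qed

subsection \<open>From sup-norm balls to \<open>\<ell>\<^sub>p\<close>-balls\<close>

lemma slice_sq_nonneg: "0 \<le> slice_sq m n t i l"
  unfolding slice_sq_def by (simp add: sum_nonneg)

lemma sum_slice:
  assumes "u < m"
  shows "(\<Sum>v<n. \<Sum>j\<in>{j\<in>idx m n. j u = v}. h j) = (\<Sum>j\<in>idx m n. h j)"
  using assms finite_idx by (intro sum.group) auto

lemma sum_powr_le_powr_sum:
  fixes f :: "'b \<Rightarrow> real"
  assumes "finite S" "\<And>x. x \<in> S \<Longrightarrow> 0 \<le> f x" "1 \<le> s"
  shows "(\<Sum>x\<in>S. f x powr s) \<le> sum f S powr s"
proof -
  have "f x powr s \<le> f x * sum f S powr (s - 1)" if "x \<in> S" for x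
  proof -
    have "f x powr s = f x * f x powr (s - 1)" using assms that by (simp add: powr_mult_base)
    also have "\<dots> \<le> f x * sum f S powr (s - 1)"
      using assms that by (intro mult_left_mono powr_mono2 member_le_sum) auto
    finally show ?thesis .
  qed
  then have "(\<Sum>x\<in>S. f x powr s) \<le> (\<Sum>x\<in>S. f x * sum f S powr (s - 1))" by (rule sum_mono)
  also have "\<dots> = sum f S * sum f S powr (s - 1)" by (simp add: sum_distrib_right)
  also have "\<dots> = sum f S powr s" using assms by (simp add: powr_mult_base sum_nonneg)
  finally show ?thesis .
qed

text \<open>Multiplication by \<open>w\<close> maps the sup-norm ball into the l_p-ball. Placing
  \<open>w\<close> in the array therefore moves \<open>u\<close> from the l_p-variables to the
  sup-norm variables, which makes an induction on the size of \<open>U\<close> possible.\<close>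

lemma ball_bounded_twist:
  assumes b: "ball_bounded m n p (insert u U) t" and u: "u < m" "u \<notin> U"
    and w: "\<And>v. 0 \<le> w v" "(\<Sum>v<n. w v powr p) \<le> 1" and p: "0 < p"
  shows "ball_bounded m n p U (\<lambda>j. t j * w (j u))"
  unfolding ball_bounded_def
proof (intro allI impI)
  fix x assume x: "\<forall>i\<in>U. (\<Sum>l<n. \<bar>x i l\<bar> powr p) \<le> 1" "\<forall>i\<in>{..<m} - U. \<forall>l<n. \<bar>x i l\<bar> \<le> 1"
  define x' where "x' = x(u := \<lambda>l. w l * x u l)"
  have xu: "\<bar>x u l\<bar> \<le> 1" if "l < n" for l using x u that by auto
  have "(\<Sum>l<n. \<bar>x' u l\<bar> powr p) \<le> (\<Sum>l<n. w l powr p)"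
  proof (intro sum_mono)
    fix l assume "l \<in> {..<n}"
    then have "w l * \<bar>x u l\<bar> \<le> w l" using xu[of l] w(1)[of l] mult_left_mono[of "\<bar>x u l\<bar>" 1 "w l"] by simp
    then show "\<bar>x' u l\<bar> powr p \<le> w l powr p" unfolding x'_def using w p
      by (intro powr_mono2) (auto simp: abs_mult)
  qed
  then have "(\<Sum>l<n. \<bar>x' u l\<bar> powr p) \<le> 1" using w by simp
  then have "\<forall>i\<in>insert u U. (\<Sum>l<n. \<bar>x' i l\<bar> powr p) \<le> 1"
    "\<forall>i\<in>{..<m} - insert u U. \<forall>l<n. \<bar>x' i l\<bar> \<le> 1"
    using x unfolding x'_def by auto
  then have "\<bar>array_form m n t x'\<bar> \<le> 1"
    by (rule b[unfolded ball_bounded_def, THEN spec, THEN mp, THEN mp])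
  also have "array_form m n t x' = array_form m n (\<lambda>j. t j * w (j u)) x"
    unfolding array_form_def
  proof (intro sum.cong refl)
    fix j
    have "(\<Prod>i<m. x' i (j i)) = w (j u) * (x u (j u) * (\<Prod>i\<in>{..<m} - {u}. x' i (j i)))"
      using u unfolding x'_def by (subst prod.remove[of _ u]) auto
    also have "(\<Prod>i\<in>{..<m} - {u}. x' i (j i)) = (\<Prod>i\<in>{..<m} - {u}. x i (j i))"
      unfolding x'_def by (intro prod.cong) auto
    also have "x u (j u) * (\<Prod>i\<in>{..<m} - {u}. x i (j i)) = (\<Prod>i<m. x i (j i))"
      using u by (subst (2) prod.remove[of _ u]) auto
    finally show "t j * (\<Prod>i<m. x' i (j i)) = t j * w (j u) * (\<Prod>i<m. x i (j i))" by simp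
  qed
  finally show "\<bar>array_form m n (\<lambda>j. t j * w (j u)) x\<bar> \<le> 1" .
qed

text \<open>The induction invariant: mixed norms with inner exponent 2 as long as the outer exponent
  is at most 2, the full power sum afterwards. At \<open>s = 2\<close> every slicing gives the full
  sum of squares, so the two regimes agree there.\<close>

definition mixed_ok :: "nat \<Rightarrow> nat \<Rightarrow> real \<Rightarrow> real \<Rightarrow> ((nat \<Rightarrow> nat) \<Rightarrow> real) \<Rightarrow> bool" where
  "mixed_ok m n C s t \<longleftrightarrow>
     (s \<le> 2 \<longrightarrow> (\<forall>i<m. (\<Sum>l<n. slice_sq m n t i l powr (s / 2)) \<le> C)) \<and>
     (2 \<le> s \<longrightarrow> (\<Sum>j\<in>idx m n. \<bar>t j\<bar> powr s) \<le> C)"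

lemma sum_slice_sq:
  assumes "i < m"
  shows "(\<Sum>l<n. slice_sq m n t i l) = (\<Sum>j\<in>idx m n. (t j)\<^sup>2)"
  unfolding slice_sq_def by (rule sum_slice[OF assms])

lemma abs_powr_eq_sq: "\<bar>x::real\<bar> powr s = (x\<^sup>2) powr (s / 2)"
proof -
  have "(\<bar>x\<bar> powr 2) powr (s / 2) = \<bar>x\<bar> powr s" by (simp only: powr_powr) simp
  moreover have "\<bar>x\<bar> powr 2 = x\<^sup>2" by (subst powr_numeral) auto
  ultimately show ?thesis by simp
qed

text \<open>On slices in direction \<open>u\<close> the weight is constant, so \<open>low\<close>
  and the case \<open>\<kappa> > 2\<close> of \<open>second\<close> are duality through
  \<open>dual_sum_powr_bound\<close>, with constant \<open>C1\<close>. In another direction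
  \<open>i\<close> the weight varies within a slice, and \<open>first\<close> transposes the bound
  of direction \<open>u\<close>, which produces the larger constant.\<close>

lemma mixed_ok_step:
  assumes u: "u < m" and \<kappa>: "0 < \<kappa>" "\<kappa> < p" "\<kappa> < \<mu>" "1 / \<mu> = 1 / \<kappa> - 1 / p" and C: "1 \<le> C"
    and tw: "\<And>w. (\<And>v. 0 \<le> w v) \<Longrightarrow> (\<Sum>v<n. w v powr p) \<le> 1 \<Longrightarrow>
      mixed_ok m n C \<kappa> (\<lambda>j. t j * w (j u))"
  defines "C1 \<equiv> C powr (p / (p - \<kappa>))"
  shows "mixed_ok m n (C * C1 powr (\<kappa> / p) + C1) \<mu> t"
proof -
  have p0: "p > 0" using \<kappa> by simp
  have C1: "1 \<le> C1" unfolding C1_def using C \<kappa> by (intro ge_one_powr_ge_zero) auto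
  have D: "C1 \<le> C * C1 powr (\<kappa> / p) + C1" using C by simp
  have tw_sq: "slice_sq m n (\<lambda>j. t j * w (j u)) i l =
      (\<Sum>v<n. (\<Sum>j\<in>{j\<in>idx m n. j i = l \<and> j u = v}. (t j)\<^sup>2) * (w v)\<^sup>2)" for w i l
  proof -
    have "slice_sq m n (\<lambda>j. t j * w (j u)) i l
      = (\<Sum>v<n. \<Sum>j\<in>{j\<in>{j\<in>idx m n. j i = l}. j u = v}. (t j)\<^sup>2 * (w (j u))\<^sup>2)"
      unfolding slice_sq_def power_mult_distrib using finite_idx u
      by (intro sum.group[symmetric]) (auto intro: finite_subset)
    also have "\<dots> = (\<Sum>v<n. (\<Sum>j\<in>{j\<in>idx m n. j i = l \<and> j u = v}. (t j)\<^sup>2) * (w v)\<^sup>2)"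
      unfolding sum_distrib_right by (intro sum.cong refl) auto
    finally show ?thesis .
  qed
  have tw_u: "slice_sq m n (\<lambda>j. t j * w (j u)) u l = slice_sq m n t u l * (w l)\<^sup>2" for w l
    unfolding slice_sq_def by (simp add: sum_distrib_right power_mult_distrib)
  have sq: "(sqrt a * b) powr s = (a * b\<^sup>2) powr (s / 2)" if "0 \<le> a" "0 \<le> b" for a b s :: real
    using abs_powr_eq_sq[of "sqrt a * b" s] that by (simp add: power_mult_distrib)
  have low: "(\<Sum>v<n. slice_sq m n t u v powr (\<mu> / 2)) \<le> C1" if k2: "\<kappa> \<le> 2"
  proof -
    have "(\<Sum>v<n. sqrt (slice_sq m n t u v) powr \<mu>) \<le> C1"
      unfolding C1_def
    proof (rule dual_sum_powr_bound)
      fix w :: "nat \<Rightarrow> real" assume w: "\<And>v. 0 \<le> w v" "(\<Sum>v<n. w v powr p) \<le> 1"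
      have "(\<Sum>l<n. slice_sq m n (\<lambda>j. t j * w (j u)) u l powr (\<kappa> / 2)) \<le> C"
        using tw[OF w] k2 u unfolding mixed_ok_def by auto
      then show "(\<Sum>v<n. (sqrt (slice_sq m n t u v) * w v) powr \<kappa>) \<le> C"
        unfolding tw_u using w slice_sq_nonneg by (simp add: sq)
    qed (use \<kappa> C slice_sq_nonneg in auto)
    then show ?thesis using slice_sq_nonneg sq[where b = 1] by simp
  qed
  have first: "(\<Sum>l<n. slice_sq m n t i l powr (\<mu> / 2)) \<le> C * C1 powr (\<kappa> / p) + C1"
    if "\<mu> \<le> 2" "i < m" for i
  \<comment> \<open>For \<mu> = 2 the sum over slices is the same in every direction, so direction
    \<open>u\<close> suffices; the transposition requires \<mu> < 2.\<close>
  proof (cases "i = u \<or> \<mu> = 2")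
    case True
    have "(\<Sum>l<n. slice_sq m n t i l powr (\<mu> / 2)) = (\<Sum>l<n. slice_sq m n t u l powr (\<mu> / 2))"
    proof (cases "i = u")
      case False
      then have "\<mu> / 2 = 1" using True by simp
      then show ?thesis
        using sum_slice_sq[OF u, of n t] sum_slice_sq[OF that(2), of n t] by (simp add: slice_sq_nonneg)
    qed simp
    then show ?thesis using low D that(1) \<kappa>(3) by linarith
  next
    case False
    then have mu2: "\<mu> < 2" using that by simp
    define A where "A l v = (\<Sum>j\<in>{j\<in>idx m n. j i = l \<and> j u = v}. (t j)\<^sup>2)" for l v
    have row: "slice_sq m n t i l = (\<Sum>v<n. A l v)" for l
      using tw_sq[of "\<lambda>_. 1" i l] unfolding A_def by simp
    have col: "slice_sq m n t u v = (\<Sum>l<n. A l v)" for v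
    proof -
      have "slice_sq m n t u v = (\<Sum>l<n. \<Sum>j\<in>{j\<in>{j\<in>idx m n. j u = v}. j i = l}. (t j)\<^sup>2)"
        unfolding slice_sq_def using finite_idx that(2)
        by (intro sum.group[symmetric]) (auto intro: finite_subset)
      also have "\<dots> = (\<Sum>l<n. A l v)"
        unfolding A_def by (intro sum.cong refl) auto
      finally show ?thesis .
    qed
    show ?thesis unfolding row
    proof (rule transposed_sum_powr_bound)
      show "(\<Sum>v<n. (\<Sum>l<n. A l v) powr (\<mu> / 2)) \<le> C1"
        using low \<kappa> mu2 unfolding col by simp
      fix w :: "nat \<Rightarrow> real" assume w: "\<And>v. 0 \<le> w v" "(\<Sum>v<n. w v powr p) \<le> 1"
      show "(\<Sum>l<n. (\<Sum>v<n. A l v * (w v)\<^sup>2) powr (\<kappa> / 2)) \<le> C"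
        using tw[OF w] \<kappa> mu2 that(2) unfolding mixed_ok_def tw_sq A_def by auto
    qed (rule \<kappa> mu2 C1 p0 finite_lessThan | simp add: A_def sum_nonneg)+
  qed
  have second: "(\<Sum>j\<in>idx m n. \<bar>t j\<bar> powr \<mu>) \<le> C1" if mu2: "2 \<le> \<mu>"
  \<comment> \<open>In both cases the outer exponent \<mu> is at least the inner one (2 or
    \<kappa>), so summing within a slice before taking the outer power only increases the
    result.\<close>
  proof (cases "\<kappa> \<le> 2")
    case True
    have "(\<Sum>j\<in>idx m n. \<bar>t j\<bar> powr \<mu>) = (\<Sum>v<n. \<Sum>j\<in>{j\<in>idx m n. j u = v}. (t j)\<^sup>2 powr (\<mu> / 2))"
      unfolding abs_powr_eq_sq by (rule sum_slice[OF u, symmetric])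
    also have "\<dots> \<le> (\<Sum>v<n. slice_sq m n t u v powr (\<mu> / 2))"
      unfolding slice_sq_def using finite_idx mu2
      by (intro sum_mono sum_powr_le_powr_sum) (auto intro: finite_subset)
    finally show ?thesis using low[OF True] by simp
  next
    case False
    define b where "b v = (\<Sum>j\<in>{j\<in>idx m n. j u = v}. \<bar>t j\<bar> powr \<kappa>)" for v
    have b0: "0 \<le> b v" for v unfolding b_def by (simp add: sum_nonneg)
    have "(\<Sum>v<n. (b v powr (1 / \<kappa>)) powr \<mu>) \<le> C1"
      unfolding C1_def
    proof (rule dual_sum_powr_bound)
      fix w :: "nat \<Rightarrow> real" assume w: "\<And>v. 0 \<le> w v" "(\<Sum>v<n. w v powr p) \<le> 1"
      have "(\<Sum>v<n. (b v powr (1 / \<kappa>) * w v) powr \<kappa>) = (\<Sum>v<n. b v * w v powr \<kappa>)"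
        using w b0 \<kappa> by (simp add: powr_mult powr_powr)
      also have "\<dots> = (\<Sum>v<n. \<Sum>j\<in>{j\<in>idx m n. j u = v}. \<bar>t j * w (j u)\<bar> powr \<kappa>)"
        unfolding b_def sum_distrib_right using w
        by (intro sum.cong refl) (auto simp: abs_mult powr_mult)
      also have "\<dots> = (\<Sum>j\<in>idx m n. \<bar>t j * w (j u)\<bar> powr \<kappa>)" by (rule sum_slice[OF u])
      also have "\<dots> \<le> C" using tw[OF w] False unfolding mixed_ok_def by auto
      finally show "(\<Sum>v<n. (b v powr (1 / \<kappa>) * w v) powr \<kappa>) \<le> C" .
    qed (use \<kappa> C in auto)
    then have B: "(\<Sum>v<n. b v powr (\<mu> / \<kappa>)) \<le> C1" by (simp add: powr_powr)
    have "(\<Sum>j\<in>idx m n. \<bar>t j\<bar> powr \<mu>) = (\<Sum>v<n. \<Sum>j\<in>{j\<in>idx m n. j u = v}. (\<bar>t j\<bar> powr \<kappa>) powr (\<mu> / \<kappa>))"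
      unfolding powr_powr using sum_slice[OF u, symmetric] \<kappa> by simp
    also have "\<dots> \<le> (\<Sum>v<n. b v powr (\<mu> / \<kappa>))"
      unfolding b_def using finite_idx \<kappa>
      by (intro sum_mono sum_powr_le_powr_sum) (auto intro: finite_subset)
    finally show ?thesis using B by simp
  qed
  have "(\<Sum>j\<in>idx m n. \<bar>t j\<bar> powr \<mu>) \<le> C * C1 powr (\<kappa> / p) + C1" if "2 \<le> \<mu>"
    using second[OF that] D by (rule order_trans)
  with first show ?thesis unfolding mixed_ok_def by blast
qed

text \<open>Each variable in \<open>U\<close> subtracts 1/p from the reciprocal of the outer
  exponent, which starts at 1; hence 1 - k/p after k variables. \<open>C\<close> precedes the
  quantifiers over \<open>n\<close>, \<open>t\<close> and \<open>U\<close> because the step applies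
  the induction hypothesis to weighted arrays and a smaller \<open>U\<close>.\<close>

lemma mixed_ok_of_ball_bounded:
  assumes p: "real m < p" and "k \<le> m"
  shows "\<exists>C\<ge>1. \<forall>n t U. U \<subseteq> {..<m} \<longrightarrow> card U = k \<longrightarrow> ball_bounded m n p U t \<longrightarrow>
    mixed_ok m n C (p / (p - real k)) t"
  using assms(2)
proof (induction k)
  case 0
  have p0: "p > 0" using p by linarith
  show ?case
  proof (intro exI[of _ "2 ^ (m - 1)"] conjI allI impI)
    fix n t and U :: "nat set" assume "U \<subseteq> {..<m}" "card U = 0" "ball_bounded m n p U t"
    moreover from this have "U = {}" using finite_subset by fastforce
    ultimately show "mixed_ok m n (2 ^ (m - 1)) (p / (p - real 0)) t"
      using p0 mixed_Littlewood[of m n p t] slice_sq_nonneg unfolding mixed_ok_def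
      by (simp add: powr_half_sqrt)
  qed simp
next
  case (Suc k)
  then obtain C where C: "1 \<le> C" and IH: "\<And>n t U. U \<subseteq> {..<m} \<Longrightarrow> card U = k \<Longrightarrow>
    ball_bounded m n p U t \<Longrightarrow> mixed_ok m n C (p / (p - real k)) t" by auto
  define \<kappa> \<mu> where "\<kappa> = p / (p - real k)" and "\<mu> = p / (p - real (Suc k))"
  have pk: "p - real (Suc k) > 0" "p > 0" using p Suc by linarith+
  \<comment> \<open>Duality requires \<open>\<kappa> < p\<close>, that is p - k > 1; this holds
    because k + 1 \<le> m < p.\<close>
  have "p * 1 < p * (p - real k)" using pk by (intro mult_strict_left_mono) auto
  then have "\<kappa> < p" unfolding \<kappa>_def using pk by (simp add: pos_divide_less_eq)
  moreover have "\<kappa> < \<mu>" unfolding \<kappa>_def \<mu>_def using pk by (intro divide_strict_left_mono) auto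
  moreover have "1 / \<mu> = 1 / \<kappa> - 1 / p" unfolding \<kappa>_def \<mu>_def using pk by (simp flip: diff_divide_distrib)
  ultimately have \<kappa>: "0 < \<kappa>" "\<kappa> < p" "\<kappa> < \<mu>" "1 / \<mu> = 1 / \<kappa> - 1 / p"
    using pk unfolding \<kappa>_def by auto
  define C1 where "C1 = C powr (p / (p - \<kappa>))"
  have C1: "1 \<le> C1" unfolding C1_def using C \<kappa> by (intro ge_one_powr_ge_zero) auto
  show ?case
  proof (intro exI[of _ "C * C1 powr (\<kappa> / p) + C1"] conjI allI impI)
    have "0 \<le> C * C1 powr (\<kappa> / p)" using C by simp
    then show "1 \<le> C * C1 powr (\<kappa> / p) + C1" using C1 by linarith
    fix n t and U :: "nat set" assume U: "U \<subseteq> {..<m}" "card U = Suc k" "ball_bounded m n p U t"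
    then obtain u U0 where u: "U = insert u U0" "u \<notin> U0" "card U0 = k" by (auto simp: card_Suc_eq)
    show "mixed_ok m n (C * C1 powr (\<kappa> / p) + C1) (p / (p - real (Suc k))) t"
      unfolding C1_def \<mu>_def[symmetric]
    proof (rule mixed_ok_step[of u])
      fix w :: "nat \<Rightarrow> real" assume w: "\<And>v. 0 \<le> w v" "(\<Sum>v<n. w v powr p) \<le> 1"
      show "mixed_ok m n C \<kappa> (\<lambda>j. t j * w (j u))"
        unfolding \<kappa>_def using U u pk by (intro IH[of U0] ball_bounded_twist w) auto
    qed (use u U \<kappa> C in auto)
  qed
qed

subsection \<open>Upper bounds for real arrays\<close>

text \<open>The outer root of \<open>lp_norm\<close> is dropped, as it does not affect membership in
  the unit ball, and plain coordinate functions replace vectors.\<close>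

definition in_ball :: "ereal \<Rightarrow> nat \<Rightarrow> (nat \<Rightarrow> 'a::real_normed_field) \<Rightarrow> bool" where
  "in_ball p n x \<longleftrightarrow> (if p = \<infinity> then \<forall>l<n. norm (x l) \<le> 1
     else (\<Sum>l<n. norm (x l) powr real_of_ereal p) \<le> 1)"

text \<open>An upper bound instead of a supremum, so that arrays can be scaled and estimated without
  boundedness or nonemptiness obligations.\<close>

definition form_bound ::
  "ereal \<Rightarrow> nat \<Rightarrow> nat \<Rightarrow> ((nat \<Rightarrow> nat) \<Rightarrow> 'a::real_normed_field) \<Rightarrow> real \<Rightarrow> bool" where
  "form_bound p m n t M \<longleftrightarrow> (\<forall>x. (\<forall>i<m. in_ball p n (x i)) \<longrightarrow> norm (array_form m n t x) \<le> M)"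

text \<open>The real inequality with both sides raised to the power \<open>r\<close> and the form normalised.\<close>
definition array_ineq :: "nat \<Rightarrow> real \<Rightarrow> ereal \<Rightarrow> real \<Rightarrow> bool" where
  "array_ineq m r p s \<longleftrightarrow> (\<exists>D>0. \<forall>n>0. \<forall>t::(nat \<Rightarrow> nat) \<Rightarrow> real. form_bound p m n t 1 \<longrightarrow>
     (\<Sum>j\<in>idx m n. \<bar>t j\<bar> powr r) \<le> D * real n powr (r * s))"

lemma card_idx: "real (card (idx m n)) = real n ^ m"
  by (simp add: card_PiE)

lemma Blei_of_mixed_ok:
  assumes m: "m > 0" and k: "1 \<le> \<kappa>" "\<kappa> \<le> 2" and C: "1 \<le> C" and ok: "mixed_ok m n C \<kappa> t"
    and q: "1 / q = 1 / 2 + (1 / \<kappa> - 1 / 2) / real m"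
  shows "(\<Sum>j\<in>idx m n. \<bar>t j\<bar> powr q) \<le> m * C + C ^ m"
proof (cases "\<kappa> = 2")
  case True
  then have "q = 2" using q by (simp add: field_simps)
  moreover have "(\<Sum>j\<in>idx m n. \<bar>t j\<bar> powr 2) \<le> C" using ok True unfolding mixed_ok_def by auto
  moreover have "C * 1 \<le> C * real m" using m C by (intro mult_left_mono) auto
  moreover have "0 \<le> C ^ m" using C by simp
  ultimately show ?thesis by (simp add: mult.commute)
next
  case False
  have "(\<Sum>j\<in>idx m n. (t j)\<^sup>2 powr (q / 2)) \<le> m * C + C ^ m"
  proof (rule Blei_interpolation[OF m _ k(1) _ q])
    show "\<kappa> < 2" using k False by simp
    show "(\<Sum>l<n. (\<Sum>j\<in>{j\<in>idx m n. j i = l}. (t j)\<^sup>2) powr (\<kappa> / 2)) \<le> C" if "i < m" for i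
      using ok k(2) that unfolding mixed_ok_def slice_sq_def by auto
  qed auto
  then show ?thesis unfolding abs_powr_eq_sq .
qed

text \<open>The Bohnenblust-Hille exponent 2m/(m+1), written in the shape shared with finite p. Here
  no variable ranges over an l_p-ball (\<open>U = {}\<close>, so \<kappa> = 1), and
  \<open>real m + 1\<close> is just a value above m for
  \<open>mixed_ok_of_ball_bounded\<close>.\<close>

lemma array_ineq_PInf:
  assumes m: "m > 0"
  shows "array_ineq m (1 / ((real m + 1) / (2 * real m))) \<infinity> 0"
proof -
  obtain C where C: "1 \<le> C" and ok: "\<And>n t U. U \<subseteq> {..<m} \<Longrightarrow> card U = 0 \<Longrightarrow>
    ball_bounded m n (real m + 1) U t \<Longrightarrow> mixed_ok m n C ((real m + 1) / (real m + 1 - real 0)) t"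
    using mixed_ok_of_ball_bounded[of m "real m + 1" 0] by auto
  have "(\<Sum>j\<in>idx m n. \<bar>t j\<bar> powr (1 / ((real m + 1) / (2 * real m)))) \<le> m * C + C ^ m"
    if b: "form_bound \<infinity> m n t 1" for n and t :: "(nat \<Rightarrow> nat) \<Rightarrow> real"
  proof (rule Blei_of_mixed_ok[OF m _ _ C, of 1])
    have "ball_bounded m n (real m + 1) {} t"
      using b unfolding ball_bounded_def form_bound_def in_ball_def by simp
    then show "mixed_ok m n C 1 t" using ok[of "{}" n t] m by simp
    show "1 / (1 / ((real m + 1) / (2 * real m))) = 1 / 2 + (1 / 1 - 1 / 2) / real m"
      using m by (simp add: field_simps)
  qed auto
  moreover have "0 < m * C + C ^ m" using C m by (intro add_pos_pos) auto
  ultimately show ?thesis unfolding array_ineq_def by (intro exI[of _ "m * C + C ^ m"]) auto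
qed

lemma ball_bounded_of_form_bound:
  assumes "form_bound (ereal p) m n t 1"
  shows "ball_bounded m n p {..<m} t"
  using assms unfolding ball_bounded_def form_bound_def in_ball_def by simp

text \<open>With \<kappa> = p/(p-m) the interpolated reciprocal exponent is 1/2 + (1/2 - m/p)/m =
  (m+1)/(2m) - 1/p.\<close>

lemma array_ineq_ge_2m:
  assumes m: "m > 0" and p: "2 * real m \<le> p"
  shows "array_ineq m (1 / ((real m + 1) / (2 * real m) - 1 / p)) (ereal p) 0"
proof -
  define \<kappa> where "\<kappa> = p / (p - real m)"
  have p0: "p - real m > 0" "p > 0" using p m by auto
  obtain C where C: "1 \<le> C" and ok: "\<And>n t U. U \<subseteq> {..<m} \<Longrightarrow> card U = m \<Longrightarrow>
    ball_bounded m n p U t \<Longrightarrow> mixed_ok m n C \<kappa> t"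
    using mixed_ok_of_ball_bounded[of m p m] p0 unfolding \<kappa>_def by auto
  have k: "1 \<le> \<kappa>" "\<kappa> \<le> 2" unfolding \<kappa>_def using p p0 by (auto simp: field_simps)
  have q: "1 / (1 / ((real m + 1) / (2 * real m) - 1 / p)) = 1 / 2 + (1 / \<kappa> - 1 / 2) / real m"
    unfolding \<kappa>_def using m p0 by (simp add: field_simps)
  have "(\<Sum>j\<in>idx m n. \<bar>t j\<bar> powr (1 / ((real m + 1) / (2 * real m) - 1 / p))) \<le> m * C + C ^ m"
    if "form_bound (ereal p) m n t 1" for n and t :: "(nat \<Rightarrow> nat) \<Rightarrow> real"
    using ok[OF _ _ ball_bounded_of_form_bound[OF that]] by (intro Blei_of_mixed_ok[OF m k C _ q]) auto
  moreover have "0 < m * C + C ^ m" using C m by (intro add_pos_pos) auto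
  ultimately show ?thesis unfolding array_ineq_def by (intro exI[of _ "m * C + C ^ m"]) auto
qed

lemma array_ineq_le_2m:
  assumes p: "real m < p" "p \<le> 2 * real m"
  shows "array_ineq m (p / (p - real m)) (ereal p) 0"
proof -
  define \<kappa> where "\<kappa> = p / (p - real m)"
  obtain C where C: "1 \<le> C" and ok: "\<And>n t U. U \<subseteq> {..<m} \<Longrightarrow> card U = m \<Longrightarrow>
    ball_bounded m n p U t \<Longrightarrow> mixed_ok m n C \<kappa> t"
    using mixed_ok_of_ball_bounded[of m p m] p unfolding \<kappa>_def by auto
  have k: "2 \<le> \<kappa>" unfolding \<kappa>_def using p by (auto simp: field_simps)
  have "(\<Sum>j\<in>idx m n. \<bar>t j\<bar> powr \<kappa>) \<le> C"
    if "form_bound (ereal p) m n t 1" for n and t :: "(nat \<Rightarrow> nat) \<Rightarrow> real"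
    using ok[OF _ _ ball_bounded_of_form_bound[OF that]] k unfolding mixed_ok_def by auto
  then show ?thesis unfolding array_ineq_def \<kappa>_def[symmetric] using C by (intro exI[of _ C]) auto
qed

section \<open>Passing to other values of r and p\<close>

lemma sum_powr_normalize:
  fixes t :: "'b \<Rightarrow> real"
  assumes "0 < B" "0 < q"
  shows "(\<Sum>j\<in>S. (\<bar>t j\<bar> / B powr (1 / q)) powr r) = (\<Sum>j\<in>S. \<bar>t j\<bar> powr r) / B powr (r / q)"
  using assms by (simp add: powr_divide powr_powr sum_divide_distrib)

lemma array_ineq_increase_r:
  assumes h: "array_ineq m q p 0" and r: "0 < q" "q \<le> r"
  shows "array_ineq m r p 0"
proof -
  obtain D where D: "D > 0" and H: "\<And>n t. n > 0 \<Longrightarrow> form_bound p m n t 1 \<Longrightarrow>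
    (\<Sum>j\<in>idx m n. \<bar>t j\<bar> powr q) \<le> D * real n powr (q * 0)"
    using h unfolding array_ineq_def by blast
  have "(\<Sum>j\<in>idx m n. \<bar>t j\<bar> powr r) \<le> D powr (r / q)" if n: "n > 0" "form_bound p m n t 1" for n t
  proof -
    have "(\<Sum>j\<in>idx m n. \<bar>t j\<bar> powr q) \<le> D" using H[OF n] n by simp
    then have "(\<Sum>j\<in>idx m n. (\<bar>t j\<bar> / D powr (1 / q)) powr q) \<le> 1"
      unfolding sum_powr_normalize[OF D r(1)] using D r by (simp add: pos_divide_le_eq)
    then have "(\<Sum>j\<in>idx m n. (\<bar>t j\<bar> / D powr (1 / q)) powr r) \<le> 1"
      using r finite_idx by (intro sum_powr_mono_exponent[of _ _ q r]) auto
    then show ?thesis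
      unfolding sum_powr_normalize[OF D r(1)] using D r by (simp add: pos_divide_le_eq)
  qed
  then show ?thesis unfolding array_ineq_def using D by (intro exI[of _ "D powr (r / q)"]) auto
qed

text \<open>Hoelder over the n^m coefficients costs the factor n^(m(1/r - 1/q)).\<close>

lemma array_ineq_decrease_r:
  assumes h: "array_ineq m q p s" and r: "0 < r" "r \<le> q"
  shows "array_ineq m r p (s + real m * (1 / r - 1 / q))"
proof -
  obtain D where D: "D > 0" and H: "\<And>n t. n > 0 \<Longrightarrow> form_bound p m n t 1 \<Longrightarrow>
    (\<Sum>j\<in>idx m n. \<bar>t j\<bar> powr q) \<le> D * real n powr (q * s)"
    using h unfolding array_ineq_def by blast
  have q: "q > 0" using r by simp
  have "(\<Sum>j\<in>idx m n. \<bar>t j\<bar> powr r) \<le> D powr (r / q) * real n powr (r * (s + real m * (1 / r - 1 / q)))"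
    if n: "n > 0" "form_bound p m n t 1" for n t
  proof -
    define B where "B = D * real n powr (q * s)"
    have B: "B > 0" unfolding B_def using D n by simp
    have "(\<Sum>j\<in>idx m n. (\<bar>t j\<bar> / B powr (1 / q)) powr q) \<le> 1"
      unfolding sum_powr_normalize[OF B q] using H[OF n] B q by (simp add: pos_divide_le_eq B_def)
    then have "(\<Sum>j\<in>idx m n. (\<bar>t j\<bar> / B powr (1 / q)) powr r) \<le> (real n ^ m) powr (1 - r / q)"
      using r finite_idx n by (intro sum_powr_le_card) (auto simp: card_PiE)
    then have "(\<Sum>j\<in>idx m n. \<bar>t j\<bar> powr r) \<le> (real n ^ m) powr (1 - r / q) * B powr (r / q)"
      unfolding sum_powr_normalize[OF B q] using B by (simp add: pos_divide_le_eq)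
    also have "\<dots> = D powr (r / q) * (real n powr (real m * (1 - r / q)) * real n powr (q * s * (r / q)))"
      unfolding B_def using D n by (simp add: powr_mult powr_powr mult_ac flip: powr_realpow)
    also have "real n powr (real m * (1 - r / q)) * real n powr (q * s * (r / q)) = real n powr (r * (s + real m * (1 / r - 1 / q)))"
      unfolding powr_add[symmetric] using r q by (intro arg_cong2[where f = "(powr)"]) (auto simp: field_simps)
    finally show ?thesis .
  qed
  then show ?thesis unfolding array_ineq_def using D by (intro exI[of _ "D powr (r / q)"]) auto
qed

lemma array_form_scale: "array_form m n t (\<lambda>i l. c * x i l) = c ^ m * array_form m n t x"
  unfolding array_form_def by (simp add: prod.distrib sum_distrib_left mult_ac)

lemma array_form_scale_array: "array_form m n (\<lambda>j. c * t j) x = c * array_form m n t x"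
  unfolding array_form_def by (simp add: sum_distrib_left mult_ac)

text \<open>\<open>1/p\<close> with \<open>1/\<infinity> = 0\<close>.\<close>
definition inv_exponent :: "ereal \<Rightarrow> real" where
  "inv_exponent p = (if p = \<infinity> then 0 else 1 / real_of_ereal p)"

lemma in_ball_shrink:
  assumes x: "in_ball p' n x" and p: "0 < p" "ereal p \<le> p'" and n: "n > 0"
    and c: "norm c = real n powr - (1 / p - inv_exponent p')"
  shows "in_ball (ereal p) n (\<lambda>l. c * x l)"
proof -
  have key: "(\<Sum>l<n. norm (x l) powr p) \<le> real n powr (1 - p * inv_exponent p')"
  proof (cases "p' = \<infinity>")
    case True
    have "(\<Sum>l<n. norm (x l) powr p) \<le> (\<Sum>l<n. 1)"
      using x True p unfolding in_ball_def by (intro sum_mono powr_le1) auto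
    then show ?thesis using True n by (simp add: inv_exponent_def)
  next
    case False
    then obtain q where q: "p' = ereal q" "p \<le> q" using p by (cases p') auto
    have "(\<Sum>l<n. norm (x l) powr p) \<le> real n powr (1 - p / q)"
      using x q p n unfolding in_ball_def by (intro sum_powr_le_card) auto
    then show ?thesis using q by (simp add: inv_exponent_def)
  qed
  have "(\<Sum>l<n. norm (c * x l) powr p) = norm c powr p * (\<Sum>l<n. norm (x l) powr p)"
    by (simp add: norm_mult powr_mult sum_distrib_left)
  also have "\<dots> \<le> norm c powr p * real n powr (1 - p * inv_exponent p')"
    using key by (intro mult_left_mono) auto
  also have "\<dots> = real n powr (- (1 / p - inv_exponent p') * p + (1 - p * inv_exponent p'))"
    unfolding c by (simp add: powr_powr flip: powr_add)
  also have "- (1 / p - inv_exponent p') * p + (1 - p * inv_exponent p') = 0"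
    using p by (simp add: algebra_simps)
  finally show ?thesis using n unfolding in_ball_def by simp
qed

text \<open>The unit ball for p' lies in n^(1/p - 1/p') times the one for p, and each of the m
  variables pays this factor. This serves both the upper bounds and the random forms.\<close>

lemma form_bound_change_p:
  fixes t :: "(nat \<Rightarrow> nat) \<Rightarrow> 'a::real_normed_field"
  assumes t: "form_bound (ereal p) m n t M" and p: "0 < p" "ereal p \<le> p'" and n: "n > 0"
  shows "form_bound p' m n t (real n powr (real m * (1 / p - inv_exponent p')) * M)"
  unfolding form_bound_def
proof (intro allI impI)
  fix x :: "nat \<Rightarrow> nat \<Rightarrow> 'a" assume x: "\<forall>i<m. in_ball p' n (x i)"
  define d where "d = 1 / p - inv_exponent p'"
  define c :: 'a where "c = of_real (real n powr - d)"
  have c: "norm c = real n powr - d" unfolding c_def by simp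
  have "norm (array_form m n t (\<lambda>i l. c * x i l)) \<le> M"
    using x by (intro t[unfolded form_bound_def, rule_format] in_ball_shrink[OF _ p n c[unfolded d_def]]) auto
  then have "real n powr - (real m * d) * norm (array_form m n t x) \<le> M"
    using n by (simp add: array_form_scale norm_mult norm_power c powr_powr mult.commute flip: powr_realpow)
  then have "real n powr (real m * d) * (real n powr - (real m * d) * norm (array_form m n t x)) \<le> real n powr (real m * d) * M"
    by (intro mult_left_mono) auto
  then show "norm (array_form m n t x) \<le> real n powr (real m * (1 / p - inv_exponent p')) * M"
    using n unfolding d_def[symmetric] by (simp add: powr_minus_divide)
qed

lemma array_ineq_decrease_p:
  assumes h: "array_ineq m r p' s" and r: "0 < r" and p: "0 < p" "ereal p \<le> p'"
  shows "array_ineq m r (ereal p) (s + real m * (1 / p - inv_exponent p'))"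
proof -
  obtain D where D: "D > 0" and H: "\<And>n t. n > 0 \<Longrightarrow> form_bound p' m n t 1 \<Longrightarrow>
    (\<Sum>j\<in>idx m n. \<bar>t j\<bar> powr r) \<le> D * real n powr (r * s)"
    using h unfolding array_ineq_def by blast
  define d where "d = real m * (1 / p - inv_exponent p')"
  have "(\<Sum>j\<in>idx m n. \<bar>t j\<bar> powr r) \<le> D * real n powr (r * (s + d))"
    if n: "n > 0" and t: "form_bound (ereal p) m n t 1" for n t
  proof -
    have "form_bound p' m n (\<lambda>j. real n powr - d * t j) 1"
      using form_bound_change_p[OF t p n] n unfolding form_bound_def array_form_scale_array d_def
      by (simp add: abs_mult powr_minus_divide pos_divide_le_eq)
    then have "(\<Sum>j\<in>idx m n. \<bar>real n powr - d * t j\<bar> powr r) \<le> D * real n powr (r * s)" by (rule H[OF n])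
    also have "(\<Sum>j\<in>idx m n. \<bar>real n powr - d * t j\<bar> powr r) = (\<Sum>j\<in>idx m n. \<bar>t j\<bar> powr r) / real n powr (r * d)"
      by (simp add: abs_mult powr_mult powr_powr powr_minus_divide powr_divide mult.commute sum_divide_distrib)
    finally show ?thesis using n by (simp add: pos_divide_le_eq powr_add distrib_left mult.assoc)
  qed
  then show ?thesis unfolding array_ineq_def d_def using D by blast
qed

subsection \<open>Multilinear forms and arrays\<close>

lemma lp_norm_le_1_iff:
  assumes "v \<in> carrier_vec n" "n > 0" "0 < p"
  shows "lp_norm p v \<le> 1 \<longleftrightarrow> in_ball p n (\<lambda>l. v $ l)"
proof (cases "p = \<infinity>")
  case True
  have "(\<lambda>j. norm (v $ j)) ` {..<n} \<noteq> {}" using assms by auto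
  then show ?thesis using assms True unfolding lp_norm_def in_ball_def by (auto simp: Max_le_iff)
next
  case False
  then obtain q where q: "p = ereal q" "q > 0" using assms by (cases p) auto
  define S where "S = (\<Sum>l<n. norm (v $ l) powr q)"
  have S0: "0 \<le> S" unfolding S_def by (simp add: sum_nonneg)
  have "S powr (1 / q) \<le> 1 \<longleftrightarrow> S \<le> 1"
  proof
    assume "S \<le> 1"
    then show "S powr (1 / q) \<le> 1" using S0 q by (intro powr_le1) auto
  next
    assume *: "S powr (1 / q) \<le> 1"
    show "S \<le> 1"
    proof (rule ccontr)
      assume "\<not> S \<le> 1"
      then have "S powr (1 / q) > 1" using q by (intro gr_one_powr) auto
      then show False using * by simp
    qed
  qed
  then show ?thesis using assms q unfolding lp_norm_def in_ball_def S_def by auto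
qed

lemma multilinear_slot:
  assumes T: "multilinear_form m n T" and w: "w \<in> vec_tuples m n" and k: "k < m"
  shows "T (w(k := vec n f)) = (\<Sum>l<n. f l * T (w(k := unit_vec n l)))"
proof -
  have add: "T (w(k := u + v)) = T (w(k := u)) + T (w(k := v))"
    if "u \<in> carrier_vec n" "v \<in> carrier_vec n" for u v
    using T w k that unfolding multilinear_form_def by blast
  have scale: "T (w(k := c \<cdot>\<^sub>v u)) = c * T (w(k := u))" if "u \<in> carrier_vec n" for u c
    using T w k that unfolding multilinear_form_def by blast
  have "T (w(k := vec n (\<lambda>l. if l < q then f l else 0))) = (\<Sum>l<q. f l * T (w(k := unit_vec n l)))"
    if "q \<le> n" for q
    using that
  proof (induction q)
    case 0
    have "vec n (\<lambda>l. if l < 0 then f l else 0) = 0 \<cdot>\<^sub>v vec n f" by (intro eq_vecI) auto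
    moreover have "T (w(k := 0 \<cdot>\<^sub>v vec n f)) = 0 * T (w(k := vec n f))" by (rule scale) simp
    ultimately show ?case by (simp only: mult_zero_left lessThan_0 sum.empty)
  next
    case (Suc q)
    define a where "a = vec n (\<lambda>l. if l < q then f l else 0)"
    have e: "vec n (\<lambda>l. if l < Suc q then f l else 0) = a + f q \<cdot>\<^sub>v unit_vec n q"
      unfolding a_def using Suc.prems by (intro eq_vecI) (auto simp: less_Suc_eq)
    have "T (w(k := a + f q \<cdot>\<^sub>v unit_vec n q)) = T (w(k := a)) + T (w(k := f q \<cdot>\<^sub>v unit_vec n q))"
      by (rule add) (simp_all add: a_def)
    also have "T (w(k := a)) = (\<Sum>l<q. f l * T (w(k := unit_vec n l)))"
      unfolding a_def using Suc.prems by (intro Suc.IH) simp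
    also have "T (w(k := f q \<cdot>\<^sub>v unit_vec n q)) = f q * T (w(k := unit_vec n q))"
      by (rule scale) simp
    finally show ?case by (simp only: e sum.lessThan_Suc)
  qed
  moreover have "vec n (\<lambda>l. if l < n then f l else 0) = vec n f" by (intro eq_vecI) auto
  ultimately show ?thesis by (metis order_refl)
qed

text \<open>The first \<open>k\<close> slots are expanded over the basis while \<open>z\<close>
  fills the rest. The induction is over arbitrary \<open>z\<close>, because the step stores
  \<open>vec n (x k)\<close> in slot \<open>k\<close> of \<open>z\<close> and then expands that slot
  by \<open>multilinear_slot\<close>.\<close>

lemma multilinear_expand:
  fixes T :: "(nat \<Rightarrow> 'a::real_normed_field vec) \<Rightarrow> 'a"
  assumes T: "multilinear_form m n T" and "z \<in> vec_tuples m n" "k \<le> m"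
  shows "T (\<lambda>i\<in>{..<m}. if i < k then vec n (x i) else z i) = (\<Sum>j\<in>idx k n.
    (\<Prod>i<k. x i (j i)) * T (\<lambda>i\<in>{..<m}. if i < k then unit_vec n (j i) else z i))"
  using assms(2,3)
proof (induction k arbitrary: z)
  case 0
  then show ?case by simp
next
  case (Suc k)
  define W where "W j = (\<lambda>i\<in>{..<m}. if i < k then unit_vec n (j i) else z i)" for j :: "nat \<Rightarrow> nat"
  define z' where "z' = z(k := vec n (x k))"
  have z': "z' \<in> vec_tuples m n" unfolding z'_def vec_tuples_def using Suc
    by (auto simp: vec_tuples_def PiE_iff extensional_def)
  have W: "W j \<in> vec_tuples m n" for j
    unfolding W_def vec_tuples_def using Suc by (auto simp: vec_tuples_def)
  have "T (\<lambda>i\<in>{..<m}. if i < Suc k then vec n (x i) else z i)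
      = T (\<lambda>i\<in>{..<m}. if i < k then vec n (x i) else z' i)"
    unfolding z'_def by (intro arg_cong[of _ _ T]) (auto simp: fun_eq_iff restrict_def)
  also have "\<dots> = (\<Sum>j\<in>idx k n. (\<Prod>i<k. x i (j i)) * T (\<lambda>i\<in>{..<m}. if i < k then unit_vec n (j i) else z' i))"
    using Suc.prems by (intro Suc.IH[OF z']) simp
  also have "\<dots> = (\<Sum>j\<in>idx k n. (\<Prod>i<k. x i (j i)) * T ((W j)(k := vec n (x k))))"
    using Suc unfolding z'_def W_def
    by (intro sum.cong refl arg_cong2[where f = times] arg_cong[of _ _ T]) (auto simp: fun_eq_iff restrict_def)
  also have "\<dots> = (\<Sum>j\<in>idx k n. \<Sum>l<n. (\<Prod>i<k. x i (j i)) * x k l * T ((W j)(k := unit_vec n l)))"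
    using Suc W by (simp add: multilinear_slot[OF T] sum_distrib_left mult.assoc)
  also have "\<dots> = (\<Sum>l<n. \<Sum>j\<in>idx k n. (\<Prod>i<k. x i (j i)) * x k l * T ((W j)(k := unit_vec n l)))"
    by (rule sum.swap)
  also have "\<dots> = (\<Sum>l<n. \<Sum>j\<in>idx k n. (\<Prod>i<Suc k. x i ((j(k := l)) i)) *
      T (\<lambda>i\<in>{..<m}. if i < Suc k then unit_vec n ((j(k := l)) i) else z i))"
  proof (intro sum.cong refl arg_cong2[where f = times] arg_cong[of _ _ T])
    fix l j
    show "(\<Prod>i<k. x i (j i)) * x k l = (\<Prod>i<Suc k. x i ((j(k := l)) i))" by simp
    show "(W j)(k := unit_vec n l) = (\<lambda>i\<in>{..<m}. if i < Suc k then unit_vec n ((j(k := l)) i) else z i)"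
      using Suc unfolding W_def by (auto simp: fun_eq_iff restrict_def)
  qed
  also have "\<dots> = (\<Sum>j\<in>idx (Suc k) n. (\<Prod>i<Suc k. x i (j i)) *
      T (\<lambda>i\<in>{..<m}. if i < Suc k then unit_vec n (j i) else z i))"
    unfolding lessThan_Suc by (subst sum_PiE_insert) auto
  finally show ?case .
qed

definition coeff_array :: "nat \<Rightarrow> nat \<Rightarrow> ((nat \<Rightarrow> 'a::real_normed_field vec) \<Rightarrow> 'a) \<Rightarrow> (nat \<Rightarrow> nat) \<Rightarrow> 'a" where
  "coeff_array m n T j = T (\<lambda>i\<in>{..<m}. unit_vec n (j i))"

lemma restrict_lessThan_if: "(\<lambda>i\<in>{..<m::nat}. if i < m then f i else g i) = (\<lambda>i\<in>{..<m}. f i)"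
  by (auto simp: fun_eq_iff restrict_def)

lemma multilinear_eq_array_form:
  assumes T: "multilinear_form m n T" and v: "v \<in> vec_tuples m n"
  shows "T v = array_form m n (coeff_array m n T) (\<lambda>i l. v i $ l)"
proof -
  have "v = (\<lambda>i\<in>{..<m}. vec n (\<lambda>l. v i $ l))"
  proof (intro ext)
    fix i
    have "v i \<in> carrier_vec n" if "i < m" using v that unfolding vec_tuples_def by auto
    moreover have "v i = undefined" if "\<not> i < m" using v that unfolding vec_tuples_def by (auto simp: PiE_iff extensional_def)
    ultimately show "v i = (\<lambda>i\<in>{..<m}. vec n (\<lambda>l. v i $ l)) i" by (auto intro!: eq_vecI)
  qed
  then show ?thesis using multilinear_expand[OF T v order_refl, of "\<lambda>i l. v i $ l"]
    unfolding restrict_lessThan_if array_form_def coeff_array_def by (simp add: mult.commute)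
qed

lemma in_ball_coord_le_1:
  assumes "in_ball p n x" "0 < p" "l < n"
  shows "norm (x l) \<le> 1"
proof (cases "p = \<infinity>")
  case True
  then show ?thesis using assms unfolding in_ball_def by simp
next
  case False
  then obtain q where q: "p = ereal q" "q > 0" using assms by (cases p) auto
  have "norm (x l) powr q \<le> (\<Sum>l<n. norm (x l) powr q)"
    using assms by (intro member_le_sum) auto
  then have "norm (x l) powr q \<le> 1" using assms q unfolding in_ball_def by auto
  then show ?thesis using gr_one_powr[of "norm (x l)" q] q(2) by (meson linorder_not_less)
qed

lemma norm_array_form_le_sum:
  fixes x :: "nat \<Rightarrow> nat \<Rightarrow> 'a::real_normed_field"
  assumes "\<And>i. i < m \<Longrightarrow> in_ball p n (x i)" "0 < p"
  shows "norm (array_form m n t x) \<le> (\<Sum>j\<in>idx m n. norm (t j))"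
  unfolding array_form_def
proof (rule order_trans[OF norm_sum], rule sum_mono)
  fix j assume j: "j \<in> idx m n"
  have "(\<Prod>i<m. norm (x i (j i))) \<le> 1"
    using j assms by (intro prod_le_1) (auto intro: in_ball_coord_le_1)
  then have "norm (t j) * (\<Prod>i<m. norm (x i (j i))) \<le> norm (t j) * 1" by (intro mult_left_mono) auto
  then show "norm (t j * (\<Prod>i<m. x i (j i))) \<le> norm (t j)" by (simp add: norm_mult prod_norm)
qed

lemma in_ball_zero: "in_ball p n (\<lambda>l. 0)"
  by (simp add: in_ball_def)

lemma norm_le_form_norm:
  fixes T :: "(nat \<Rightarrow> 'a::real_normed_field vec) \<Rightarrow> 'a"
  assumes bdd: "bdd_above {norm (T x) | x. x \<in> vec_tuples m n \<and> (\<forall>i<m. lp_norm p (x i) \<le> 1)}"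
    and v: "v \<in> vec_tuples m n" "\<And>i. i < m \<Longrightarrow> lp_norm p (v i) \<le> 1"
  shows "norm (T v) \<le> form_norm p m n T"
  unfolding form_norm_def
proof (rule cSup_upper[OF _ bdd])
  show "norm (T v) \<in> {norm (T x) | x. x \<in> vec_tuples m n \<and> (\<forall>i<m. lp_norm p (x i) \<le> 1)}"
    using v by blast
qed

lemma bdd_above_form_values:
  fixes T :: "(nat \<Rightarrow> 'a::real_normed_field vec) \<Rightarrow> 'a"
  assumes "\<And>y. y \<in> vec_tuples m n \<Longrightarrow> \<forall>i<m. lp_norm p (y i) \<le> 1 \<Longrightarrow> norm (T y) \<le> B"
  shows "bdd_above {norm (T x) | x. x \<in> vec_tuples m n \<and> (\<forall>i<m. lp_norm p (x i) \<le> 1)}"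
  using assms by (auto intro!: bdd_aboveI[of _ B])

text \<open>The real supremum is an upper bound only for a bounded set. Coordinates in the unit ball
  have norm at most 1, so the sum of the norms of the coefficients bounds all values.\<close>

lemma form_bound_form_norm:
  fixes T :: "(nat \<Rightarrow> 'a::real_normed_field vec) \<Rightarrow> 'a"
  assumes T: "multilinear_form m n T" and n: "n > 0" and p: "0 < p"
  shows "form_bound p m n (coeff_array m n T) (form_norm p m n T)"
  unfolding form_bound_def
proof (intro allI impI)
  fix x :: "nat \<Rightarrow> nat \<Rightarrow> 'a" assume x: "\<forall>i<m. in_ball p n (x i)"
  define v where "v = (\<lambda>i\<in>{..<m}. vec n (x i))"
  have v: "v \<in> vec_tuples m n" unfolding v_def vec_tuples_def by auto
  have in_cong: "in_ball p n (\<lambda>l. v i $ l) \<longleftrightarrow> in_ball p n (x i)" if "i < m" for i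
    using that unfolding in_ball_def v_def by simp
  have "lp_norm p (v i) \<le> 1" if "i < m" for i
    using x in_cong[OF that] v n p that by (subst lp_norm_le_1_iff) (auto simp: vec_tuples_def)
  moreover have "bdd_above {norm (T x) | x. x \<in> vec_tuples m n \<and> (\<forall>i<m. lp_norm p (x i) \<le> 1)}"
  proof (rule bdd_above_form_values)
    fix y :: "nat \<Rightarrow> 'a vec" assume y: "y \<in> vec_tuples m n" "\<forall>i<m. lp_norm p (y i) \<le> 1"
    have "in_ball p n (\<lambda>l. y i $ l)" if "i < m" for i
      using y n p that lp_norm_le_1_iff[of "y i" n p] by (auto simp: vec_tuples_def)
    then have "norm (array_form m n (coeff_array m n T) (\<lambda>i l. y i $ l)) \<le>
        (\<Sum>j\<in>idx m n. norm (coeff_array m n T j))"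
      by (rule norm_array_form_le_sum[OF _ p])
    then show "norm (T y) \<le> (\<Sum>j\<in>idx m n. norm (coeff_array m n T j))"
      by (simp only: multilinear_eq_array_form[OF T y(1)])
  qed
  ultimately have le: "norm (T v) \<le> form_norm p m n T" using v by (intro norm_le_form_norm)
  have "(\<Prod>i<m. v i $ j i) = (\<Prod>i<m. x i (j i))" if "j \<in> idx m n" for j
  proof (rule prod.cong[OF refl])
    fix i assume i: "i \<in> {..<m}"
    have "j i < n" using PiE_mem[OF that i] by simp
    then show "v i $ j i = x i (j i)" using i unfolding v_def by simp
  qed
  then have Tv: "T v = array_form m n (coeff_array m n T) x"
    using multilinear_eq_array_form[OF T v] unfolding array_form_def by simp
  show "norm (array_form m n (coeff_array m n T) x) \<le> form_norm p m n T" using le unfolding Tv .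
qed

lemma form_norm_le:
  fixes T :: "(nat \<Rightarrow> 'a::real_normed_field vec) \<Rightarrow> 'a"
  assumes T: "multilinear_form m n T" and n: "n > 0" and p: "0 < p"
    and b: "form_bound p m n (coeff_array m n T) B"
  shows "form_norm p m n T \<le> B"
  unfolding form_norm_def
proof (rule cSup_least)
  define v :: "nat \<Rightarrow> 'a vec" where "v = (\<lambda>i\<in>{..<m}. vec n (\<lambda>_. 0))"
  have v: "v \<in> vec_tuples m n" unfolding v_def vec_tuples_def by auto
  have "lp_norm p (v i) \<le> 1" if "i < m" for i
    using v n p that by (subst lp_norm_le_1_iff[of _ n]) (auto simp: vec_tuples_def v_def in_ball_def)
  then show "{norm (T x) | x. x \<in> vec_tuples m n \<and> (\<forall>i<m. lp_norm p (x i) \<le> 1)} \<noteq> {}"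
    using v by blast
next
  fix a assume "a \<in> {norm (T x) | x. x \<in> vec_tuples m n \<and> (\<forall>i<m. lp_norm p (x i) \<le> 1)}"
  then obtain y where y: "a = norm (T y)" "y \<in> vec_tuples m n" "\<forall>i<m. lp_norm p (y i) \<le> 1" by blast
  have "in_ball p n (\<lambda>l. y i $ l)" if "i < m" for i
    using y n p that lp_norm_le_1_iff[of "y i" n p] by (auto simp: vec_tuples_def)
  then show "a \<le> B" unfolding y(1) multilinear_eq_array_form[OF T y(2)]
    using b unfolding form_bound_def by auto
qed

lemma array_form_unit:
  assumes j: "j \<in> idx m n" and x: "\<And>i l. i < m \<Longrightarrow> l < n \<Longrightarrow> x i l = (if l = j i then 1 else 0)"
  shows "array_form m n t x = t j"
proof -
  have jn: "j i < n" if "i < m" for i using j that by auto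
  have "t j' * (\<Prod>i<m. x i (j' i)) = (if j' = j then t j else 0)" if j': "j' \<in> idx m n" for j'
  proof (cases "j' = j")
    case True
    then have "(\<Prod>i<m. x i (j' i)) = 1" using x jn by (intro prod.neutral) auto
    then show ?thesis using True by simp
  next
    case False
    then obtain i where i: "i < m" "j' i \<noteq> j i" using j j' PiE_ext by (metis lessThan_iff)
    then have "x i (j' i) = 0" using x[of i "j' i"] j' by auto
    then have "(\<Prod>i<m. x i (j' i)) = 0" using i by (intro prod_zero) auto
    then show ?thesis using False by simp
  qed
  then show ?thesis unfolding array_form_def using j finite_idx by simp
qed

lemma coeff_array_array_form:
  assumes "j \<in> idx m n"
  shows "coeff_array m n (\<lambda>x. array_form m n t (\<lambda>i l. x i $ l)) j = t j"
  unfolding coeff_array_def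
proof (rule array_form_unit[OF assms])
  fix i l assume i: "i < m" "l < n"
  have "j i < n" using PiE_mem[OF assms, of i] i by simp
  then show "(\<lambda>i\<in>{..<m}. unit_vec n (j i)) i $ l = (if l = j i then 1 else 0)"
    using i by simp
qed

lemma multilinear_array_form:
  fixes t :: "(nat \<Rightarrow> nat) \<Rightarrow> 'a::real_normed_field"
  shows "multilinear_form m n (\<lambda>x. array_form m n t (\<lambda>i l. x i $ l))"
  unfolding multilinear_form_def
proof (intro ballI allI impI conjI)
  fix x :: "nat \<Rightarrow> 'a vec" and i and u :: "'a vec" assume i: "i < m" and u: "u \<in> carrier_vec n"
  define G where "G l = (\<Sum>j\<in>({..<m} - {i}) \<rightarrow>\<^sub>E {..<n}. t (j(i := l)) * (\<Prod>k\<in>{..<m} - {i}. x k $ j k))" for l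
  have G: "array_form m n t (\<lambda>k l. (x(i := w)) k $ l) = (\<Sum>l<n. w $ l * G l)" for w
    unfolding array_form_split[OF i] G_def by (simp cong: prod.cong_simp)
  {
    fix v :: "'a vec" assume v: "v \<in> carrier_vec n"
    show "array_form m n t (\<lambda>k l. (x(i := u + v)) k $ l) =
      array_form m n t (\<lambda>k l. (x(i := u)) k $ l) + array_form m n t (\<lambda>k l. (x(i := v)) k $ l)"
      unfolding G using u v by (simp add: sum.distrib[symmetric] distrib_right)
  }
  show "array_form m n t (\<lambda>k l. (x(i := c \<cdot>\<^sub>v u)) k $ l) = c * array_form m n t (\<lambda>k l. (x(i := u)) k $ l)" for c
    unfolding G using u by (simp add: sum_distrib_left mult.assoc)
qed

text \<open>For the lower bounds: a test array needs only some upper estimate \<open>B\<close> of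
  its norm, not the norm itself.\<close>

lemma array_of_hardy_littlewood:
  assumes h: "hardy_littlewood_ineq TYPE('a::real_normed_field) m r p s" and p: "0 < p"
  shows "\<exists>D>0. \<forall>n (t :: (nat \<Rightarrow> nat) \<Rightarrow> 'a) B. n > 0 \<longrightarrow> form_bound p m n t B \<longrightarrow>
    (\<Sum>j\<in>idx m n. norm (t j) powr r) powr (1 / r) \<le> D * real n powr s * B"
proof -
  obtain D where D: "D > 0" and H: "\<And>n (T :: (nat \<Rightarrow> 'a vec) \<Rightarrow> 'a). n > 0 \<Longrightarrow> multilinear_form m n T \<Longrightarrow>
    coeff_norm r m n T \<le> D * real n powr s * form_norm p m n T"
    using h unfolding hardy_littlewood_ineq_def by blast
  show ?thesis
  proof (intro exI[of _ D] conjI allI impI D)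
    fix n B and t :: "(nat \<Rightarrow> nat) \<Rightarrow> 'a" assume n: "n > 0" and b: "form_bound p m n t B"
    define T where "T x = array_form m n t (\<lambda>i l. x i $ l)" for x :: "nat \<Rightarrow> 'a vec"
    have T: "multilinear_form m n T" unfolding T_def by (rule multilinear_array_form)
    have c: "coeff_array m n T j = t j" if "j \<in> idx m n" for j
      unfolding T_def by (rule coeff_array_array_form[OF that])
    have "form_bound p m n (coeff_array m n T) B"
      using b unfolding form_bound_def array_form_def by (simp add: c)
    then have f: "form_norm p m n T \<le> B" by (rule form_norm_le[OF T n p])
    have "(\<Sum>j\<in>idx m n. norm (t j) powr r) powr (1 / r) = coeff_norm r m n T"
      unfolding coeff_norm_def using c unfolding coeff_array_def by simp
    also have "\<dots> \<le> D * real n powr s * form_norm p m n T" by (rule H[OF n T])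
    also have "\<dots> \<le> D * real n powr s * B" using f D by (intro mult_left_mono) auto
    finally show "(\<Sum>j\<in>idx m n. norm (t j) powr r) powr (1 / r) \<le> D * real n powr s * B" .
  qed
qed

lemma norm_coeff_le_form_bound:
  fixes t :: "(nat \<Rightarrow> nat) \<Rightarrow> 'a::real_normed_field"
  assumes b: "form_bound p m n t M" and j: "j \<in> idx m n"
  shows "norm (t j) \<le> M"
proof -
  define x :: "nat \<Rightarrow> nat \<Rightarrow> 'a" where "x i l = (if l = j i then 1 else 0)" for i l
  have "in_ball p n (x i)" if "i < m" for i
  proof -
    have ji: "j i < n" using j that by auto
    have "(\<Sum>l<n. norm (x i l) powr real_of_ereal p) = (\<Sum>l<n. if l = j i then 1 else 0)"
      unfolding x_def by (intro sum.cong) auto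
    then show ?thesis using ji unfolding in_ball_def by (simp add: x_def)
  qed
  then have "norm (array_form m n t x) \<le> M" using b unfolding form_bound_def by blast
  then show ?thesis using array_form_unit[OF j, of x t] by (simp add: x_def)
qed

lemma array_ineq_scaled:
  assumes h: "array_ineq m r p s" and r: "r > 0"
  shows "\<exists>D>0. \<forall>n (t :: (nat \<Rightarrow> nat) \<Rightarrow> real) M. n > 0 \<longrightarrow> form_bound p m n t M \<longrightarrow> 0 \<le> M \<longrightarrow>
    (\<Sum>j\<in>idx m n. \<bar>t j\<bar> powr r) \<le> D * (real n powr s * M) powr r"
proof -
  obtain D where D: "D > 0" and H: "\<And>n t. n > 0 \<Longrightarrow> form_bound p m n t 1 \<Longrightarrow>
    (\<Sum>j\<in>idx m n. \<bar>t j\<bar> powr r) \<le> D * real n powr (r * s)"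
    using h unfolding array_ineq_def by blast
  show ?thesis
  proof (intro exI[of _ D] conjI allI impI D)
    fix n M and t :: "(nat \<Rightarrow> nat) \<Rightarrow> real" assume n: "n > 0" and b: "form_bound p m n t M" and M: "0 \<le> M"
    show "(\<Sum>j\<in>idx m n. \<bar>t j\<bar> powr r) \<le> D * (real n powr s * M) powr r"
    proof (cases "M = 0")
      \<comment> \<open>A form of norm 0 cannot be normalised, but its coefficients vanish, being
        values at unit vectors.\<close>
      case True
      have "(\<Sum>j\<in>idx m n. \<bar>t j\<bar> powr r) = 0"
        using norm_coeff_le_form_bound[OF b] True by (intro sum.neutral) auto
      then show ?thesis using D by simp
    next
      case False
      have "form_bound p m n (\<lambda>j. inverse M * t j) 1"
        using b M False unfolding form_bound_def array_form_scale_array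
        by (simp add: abs_mult field_simps)
      then have "(\<Sum>j\<in>idx m n. \<bar>inverse M * t j\<bar> powr r) \<le> D * real n powr (r * s)" by (rule H[OF n])
      also have "(\<Sum>j\<in>idx m n. \<bar>inverse M * t j\<bar> powr r) = (\<Sum>j\<in>idx m n. \<bar>t j\<bar> powr r) / M powr r"
        using M False by (simp add: abs_mult powr_mult powr_divide sum_divide_distrib field_simps)
      finally show ?thesis using M False
        by (simp add: pos_divide_le_eq powr_mult powr_powr mult_ac)
    qed
  qed
qed

lemma hardy_littlewood_real:
  assumes h: "array_ineq m r p s" and r: "r > 0" and p: "0 < p"
  shows "hardy_littlewood_ineq TYPE(real) m r p s"
proof -
  obtain D where D: "D > 0" and H: "\<And>n (t :: (nat \<Rightarrow> nat) \<Rightarrow> real) M. n > 0 \<Longrightarrow> form_bound p m n t M \<Longrightarrow> 0 \<le> M \<Longrightarrow>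
    (\<Sum>j\<in>idx m n. \<bar>t j\<bar> powr r) \<le> D * (real n powr s * M) powr r"
    using array_ineq_scaled[OF h r] by blast
  have "coeff_norm r m n T \<le> D powr (1 / r) * real n powr s * form_norm p m n T"
    if n: "n > 0" and T: "multilinear_form m n T" for n and T :: "(nat \<Rightarrow> real vec) \<Rightarrow> real"
  proof -
    note b = form_bound_form_norm[OF T n p]
    have M: "0 \<le> form_norm p m n T"
      using b[unfolded form_bound_def, rule_format, of "\<lambda>_ _. 0"] by (auto simp: in_ball_zero intro: order_trans[OF norm_ge_zero])
    have "coeff_norm r m n T \<le> (D * (real n powr s * form_norm p m n T) powr r) powr (1 / r)"
      unfolding coeff_norm_def using H[OF n b M] r unfolding coeff_array_def
      by (intro powr_mono2) (auto intro: sum_nonneg)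
    then show ?thesis using D M r by (simp add: powr_mult powr_powr)
  qed
  then show ?thesis unfolding hardy_littlewood_ineq_def using D by (intro exI[of _ "D powr (1 / r)"]) auto
qed

lemma powr_add_le_two_powr:
  assumes "0 \<le> (a::real)" "0 \<le> b" "0 \<le> r"
  shows "(a + b) powr r \<le> 2 powr r * (a powr r + b powr r)"
proof -
  have "(a + b) powr r \<le> (2 * max a b) powr r" using assms by (intro powr_mono2) auto
  also have "\<dots> = 2 powr r * max a b powr r" using assms by (simp add: powr_mult)
  also have "max a b powr r \<le> a powr r + b powr r" by (simp add: max_def)
  finally show ?thesis by simp
qed

text \<open>Real points of the unit ball are also points of the complex one, and at such points the
  real and imaginary parts of the form are the forms of the two real arrays. Both inherit the bound
  \<open>M\<close>; recombining them costs the factor \<open>E / D\<close>.\<close>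

lemma hardy_littlewood_complex:
  assumes h: "array_ineq m r p s" and r: "r > 0" and p: "0 < p"
  shows "hardy_littlewood_ineq TYPE(complex) m r p s"
proof -
  obtain D where D: "D > 0" and H: "\<And>n (t :: (nat \<Rightarrow> nat) \<Rightarrow> real) M. n > 0 \<Longrightarrow> form_bound p m n t M \<Longrightarrow> 0 \<le> M \<Longrightarrow>
    (\<Sum>j\<in>idx m n. \<bar>t j\<bar> powr r) \<le> D * (real n powr s * M) powr r"
    using array_ineq_scaled[OF h r] by blast
  define E where "E = 2 powr r * (2 * D)"
  have E: "E > 0" unfolding E_def using D by simp
  have "coeff_norm r m n T \<le> E powr (1 / r) * real n powr s * form_norm p m n T"
    if n: "n > 0" and T: "multilinear_form m n T" for n and T :: "(nat \<Rightarrow> complex vec) \<Rightarrow> complex"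
  proof -
    define t where "t = coeff_array m n T"
    define M where "M = form_norm p m n T"
    have b: "form_bound p m n t M" unfolding t_def M_def by (rule form_bound_form_norm[OF T n p])
    have M: "0 \<le> M"
      using b[unfolded form_bound_def, rule_format, of "\<lambda>_ _. 0"] by (auto simp: in_ball_zero intro: order_trans[OF norm_ge_zero])
    have emb: "norm (array_form m n t (\<lambda>i l. complex_of_real (x i l))) \<le> M" if "\<forall>i<m. in_ball p n (x i)" for x
      using that by (intro b[unfolded form_bound_def, rule_format]) (auto simp: in_ball_def)
    have re: "Re (array_form m n t (\<lambda>i l. complex_of_real (x i l))) = array_form m n (\<lambda>j. Re (t j)) x"
      and im: "Im (array_form m n t (\<lambda>i l. complex_of_real (x i l))) = array_form m n (\<lambda>j. Im (t j)) x" for x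
      unfolding array_form_def of_real_prod[symmetric] by (simp_all del: of_real_prod)
    have "form_bound p m n (\<lambda>j. Re (t j)) M" "form_bound p m n (\<lambda>j. Im (t j)) M"
      unfolding form_bound_def re[symmetric] im[symmetric] real_norm_def
      using emb abs_Re_le_cmod abs_Im_le_cmod order_trans by blast+
    then have R: "(\<Sum>j\<in>idx m n. \<bar>Re (t j)\<bar> powr r) \<le> D * (real n powr s * M) powr r"
      and I: "(\<Sum>j\<in>idx m n. \<bar>Im (t j)\<bar> powr r) \<le> D * (real n powr s * M) powr r"
      using H[OF n _ M] by blast+
    have "(\<Sum>j\<in>idx m n. norm (t j) powr r) \<le> (\<Sum>j\<in>idx m n. 2 powr r * (\<bar>Re (t j)\<bar> powr r + \<bar>Im (t j)\<bar> powr r))"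
      using r by (intro sum_mono order_trans[OF powr_mono2 powr_add_le_two_powr] cmod_le) auto
    also have "\<dots> \<le> 2 powr r * (D * (real n powr s * M) powr r + D * (real n powr s * M) powr r)"
      unfolding sum_distrib_left[symmetric] sum.distrib using R I by (intro mult_left_mono add_mono) auto
    finally have "(\<Sum>j\<in>idx m n. norm (t j) powr r) \<le> 2 powr r * (2 * D) * (real n powr s * M) powr r"
      by simp
    then have "coeff_norm r m n T \<le> (2 powr r * (2 * D) * (real n powr s * M) powr r) powr (1 / r)"
      unfolding coeff_norm_def t_def coeff_array_def using r by (intro powr_mono2) (auto intro: sum_nonneg)
    then show ?thesis using E M r unfolding M_def[symmetric] E_def[symmetric] by (simp add: powr_mult powr_powr)
  qed
  then show ?thesis unfolding hardy_littlewood_ineq_def using E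
    by (intro exI[of _ "E powr (1 / r)"]) auto
qed

subsection \<open>Lower bounds for the exponent\<close>

lemma exponent_le_of_bound:
  assumes D: "D > 0" and b: "\<And>n::nat. n > 0 \<Longrightarrow> real n powr a \<le> D * real n powr s"
  shows "a \<le> s"
proof (rule ccontr)
  assume "\<not> a \<le> s"
  then have d: "a - s > 0" by simp
  define n where "n = nat \<lceil>D powr (1 / (a - s))\<rceil> + 1"
  have n: "n > 0" "real n > D powr (1 / (a - s))" unfolding n_def by linarith+
  have "D = (D powr (1 / (a - s))) powr (a - s)" using D d by (simp add: powr_powr)
  also have "\<dots> < real n powr (a - s)" using n d by (intro powr_less_mono2) auto
  also have "\<dots> \<le> D" using b[OF n(1)] n by (simp add: powr_diff pos_divide_le_eq)
  finally show False by simp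
qed

section \<open>Test forms supported on the diagonal\<close>

lemma array_form_indicator:
  fixes x :: "nat \<Rightarrow> nat \<Rightarrow> 'a::comm_semiring_1"
  assumes "A \<subseteq> idx m n"
  shows "array_form m n (\<lambda>j. if j \<in> A then 1 else 0) x = (\<Sum>j\<in>A. \<Prod>i<m. x i (j i))"
proof -
  have "array_form m n (\<lambda>j. if j \<in> A then 1 else 0) x = (\<Sum>j\<in>idx m n. if j \<in> A then \<Prod>i<m. x i (j i) else 0)"
    unfolding array_form_def by (intro sum.cong) auto
  also have "\<dots> = (\<Sum>j\<in>idx m n \<inter> A. \<Prod>i<m. x i (j i))"
    using finite_idx by (simp add: sum.inter_restrict)
  also have "idx m n \<inter> A = A" using assms by auto
  finally show ?thesis .
qed

lemma sum_norm_indicator: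
  assumes "A \<subseteq> idx m n" "0 < r"
  shows "(\<Sum>j\<in>idx m n. norm (if j \<in> A then 1 else 0 :: 'a::real_normed_field) powr r) = real (card A)"
proof -
  have "(\<Sum>j\<in>idx m n. norm (if j \<in> A then 1 else 0 :: 'a) powr r) = (\<Sum>j\<in>idx m n. if j \<in> A then 1 else 0)"
    by (intro sum.cong) auto
  also have "\<dots> = (\<Sum>j\<in>idx m n \<inter> A. 1)" by (rule sum.inter_restrict[OF finite_idx, symmetric])
  also have "idx m n \<inter> A = A" using assms by auto
  finally show ?thesis by simp
qed

lemma diagonal_subset: "(\<lambda>l. \<lambda>i\<in>{..<m}. l) ` B \<subseteq> idx m n" if "B \<subseteq> {..<n}" for B :: "nat set"
  using that by (intro image_subsetI) (simp only: restrict_PiE_iff, auto)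

lemma inj_on_diagonal: "m > 0 \<Longrightarrow> inj_on (\<lambda>l. \<lambda>i\<in>{..<m::nat}. l) B"
  by (rule inj_onI) (metis lessThan_iff restrict_apply')

lemma hardy_littlewood_exponent_nonneg:
  assumes h: "hardy_littlewood_ineq TYPE('a::real_normed_field) m r p s" and p: "0 < p" and r: "0 < r" and m: "m > 0"
  shows "0 \<le> s"
proof -
  obtain D where D: "D > 0" and H: "\<And>n (t :: (nat \<Rightarrow> nat) \<Rightarrow> 'a) B. n > 0 \<Longrightarrow> form_bound p m n t B \<Longrightarrow>
    (\<Sum>j\<in>idx m n. norm (t j) powr r) powr (1 / r) \<le> D * real n powr s * B"
    using array_of_hardy_littlewood[OF h p] by blast
  show ?thesis
  proof (rule exponent_le_of_bound[OF D])
    fix n :: nat assume n: "n > 0"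
    define A where "A = (\<lambda>l. \<lambda>i\<in>{..<m}. l) ` {0::nat}"
    have A: "A \<subseteq> idx m n" unfolding A_def using n by (intro diagonal_subset) auto
    define t where "t j = (if j \<in> A then 1 else 0 :: 'a)" for j
    have "form_bound p m n t 1"
      unfolding form_bound_def
    proof (intro allI impI)
      fix x :: "nat \<Rightarrow> nat \<Rightarrow> 'a" assume x: "\<forall>i<m. in_ball p n (x i)"
      have "array_form m n t x = (\<Sum>j\<in>A. \<Prod>i<m. x i (j i))"
        unfolding t_def by (rule array_form_indicator[OF A])
      also have "\<dots> = (\<Prod>i<m. x i 0)" unfolding A_def by (auto intro!: prod.cong)
      finally have "norm (array_form m n t x) = (\<Prod>i<m. norm (x i 0))" by (simp only: prod_norm)
      also have "\<dots> \<le> 1" using x n p by (intro prod_le_1) (auto intro: in_ball_coord_le_1)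
      finally show "norm (array_form m n t x) \<le> 1" .
    qed
    from H[OF n this] show "real n powr 0 \<le> D * real n powr s"
      unfolding t_def sum_norm_indicator[OF A r] using n by (simp add: A_def)
  qed
qed

text \<open>The diagonal form has n coefficients equal to 1. Its norm is at most m n^(1 - m/p):
  \<open>prod_root_le_sum\<close> reduces the product to m-th powers, which costs the factor m, and
  Hoelder from exponent m to p gives the power of n.\<close>

lemma hardy_littlewood_exponent_diagonal:
  assumes h: "hardy_littlewood_ineq TYPE('a::real_normed_field) m r (ereal p) s"
    and p: "real m \<le> p" and r: "0 < r" and m: "m > 0"
  shows "1 / r + real m / p - 1 \<le> s"
proof -
  have p0: "0 < p" using p m by linarith
  obtain D where D: "D > 0" and H: "\<And>n (t :: (nat \<Rightarrow> nat) \<Rightarrow> 'a) B. n > 0 \<Longrightarrow> form_bound p m n t B \<Longrightarrow>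
    (\<Sum>j\<in>idx m n. norm (t j) powr r) powr (1 / r) \<le> D * real n powr s * B"
    using array_of_hardy_littlewood[OF h] p0 by auto
  have key: "real n powr (1 / r) \<le> (D * real m) * real n powr (s + (1 - real m / p))" if n: "n > 0" for n
  proof -
    define A where "A = (\<lambda>l. \<lambda>i\<in>{..<m}. l) ` {..<n}"
    have A: "A \<subseteq> idx m n" unfolding A_def by (intro diagonal_subset) auto
    define t where "t j = (if j \<in> A then 1 else 0 :: 'a)" for j
    have "form_bound p m n t (real m * real n powr (1 - real m / p))"
      unfolding form_bound_def
    proof (intro allI impI)
      fix x :: "nat \<Rightarrow> nat \<Rightarrow> 'a" assume x: "\<forall>i<m. in_ball p n (x i)"
      have "array_form m n t x = (\<Sum>l<n. \<Prod>i<m. x i l)"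
        unfolding t_def array_form_indicator[OF A] unfolding A_def
        using m by (subst sum.reindex[OF inj_on_diagonal]) (auto intro!: sum.cong prod.cong)
      then have "norm (array_form m n t x) \<le> (\<Sum>l<n. \<Prod>i<m. norm (x i l))"
        by (simp add: prod_norm norm_sum)
      also have "\<dots> \<le> (\<Sum>l<n. \<Sum>i<m. norm (x i l) powr real m)"
      proof (rule sum_mono)
        fix l
        have "(\<Prod>i<m. norm (x i l)) = (\<Prod>i<m. (norm (x i l) powr real m) powr (1 / card {..<m}))"
          using m by (simp add: powr_powr)
        also have "\<dots> \<le> (\<Sum>i<m. norm (x i l) powr real m)"
          using m by (intro prod_root_le_sum) auto
        finally show "(\<Prod>i<m. norm (x i l)) \<le> (\<Sum>i<m. norm (x i l) powr real m)" .
      qed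
      also have "\<dots> = (\<Sum>i<m. \<Sum>l<n. norm (x i l) powr real m)" by (rule sum.swap)
      also have "\<dots> \<le> (\<Sum>i<m. real n powr (1 - real m / p))"
        using x n m p by (intro sum_mono sum_powr_le_card) (auto simp: in_ball_def)
      finally show "norm (array_form m n t x) \<le> real m * real n powr (1 - real m / p)" by simp
    qed
    from H[OF n this] have "real n powr (1 / r) \<le> D * real n powr s * (real m * real n powr (1 - real m / p))"
      unfolding t_def sum_norm_indicator[OF A r] using m by (simp add: A_def card_image inj_on_diagonal)
    then show ?thesis unfolding powr_add[of "real n" s "1 - real m / p"] by (simp only: mult_ac)
  qed
  have "0 < D * real m" using D m by simp
  from exponent_le_of_bound[OF this key] show ?thesis by simp
qed

subsection \<open>Random forms\<close>

text \<open>Lattice points of mesh \<open>1/(2\<surd>n)\<close> in the Euclidean unit ball.\<close>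
definition net :: "nat \<Rightarrow> (nat \<Rightarrow> real) set" where
  "net n = (\<lambda>z l. real_of_int (z l) / (2 * sqrt (real n))) `
     {z \<in> {..<n} \<rightarrow>\<^sub>E {- int (2 * n)..int (2 * n)}. (\<Sum>l<n. (z l)\<^sup>2) \<le> 4 * int n}"

lemma sum_half_power_abs_le: "(\<Sum>k\<in>{- int N..int N}. (1 / 2 :: real) ^ nat \<bar>k\<bar>) \<le> 3"
proof -
  have "(\<Sum>k\<in>{- int N..int N}. (1 / 2 :: real) ^ nat \<bar>k\<bar>) = 3 - 2 * (1 / 2) ^ N"
  proof (induction N)
    case (Suc N)
    have "{- int (Suc N)..int (Suc N)} = insert (- int (Suc N)) (insert (int (Suc N)) {- int N..int N})" by auto
    then show ?case using Suc by (simp add: nat_add_distrib)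
  qed simp
  then show ?thesis by simp
qed

lemma finite_net: "finite (net n)"
  unfolding net_def by (intro finite_imageI finite_subset[OF Collect_subset] finite_PiE) auto

text \<open>Give the integer point \<open>z\<close> the weight 2 to the power minus the sum of
  \<open>\<bar>z l\<bar>\<close>. Since \<open>\<bar>k\<bar> \<le> k\<^sup>2\<close> for integers,
  points of \<open>Z'\<close> have weight at least 16^(-n), while the total weight of the box
  factors and is at most 3^n; and 16 * 3 = 48.\<close>

lemma card_net: "real (card (net n)) \<le> 48 ^ n"
proof -
  define Z where "Z = {..<n} \<rightarrow>\<^sub>E {- int (2 * n)..int (2 * n)}"
  define Z' where "Z' = {z \<in> Z. (\<Sum>l<n. (z l)\<^sup>2) \<le> 4 * int n}"
  have fin: "finite Z" unfolding Z_def by (intro finite_PiE) auto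
  have "card (net n) \<le> card Z'"
    unfolding net_def Z'_def Z_def[symmetric] using fin by (intro card_image_le) auto
  then have "real (card (net n)) \<le> (\<Sum>z\<in>Z'. 1)" by simp
  also have "\<dots> \<le> (\<Sum>z\<in>Z'. 16 ^ n * (\<Prod>l<n. (1 / 2) ^ nat \<bar>z l\<bar>))"
  proof (rule sum_mono)
    fix z assume z: "z \<in> Z'"
    have sq: "\<bar>k\<bar> \<le> k\<^sup>2" for k :: int
    proof (cases "k = 0")
      case False
      then have "\<bar>k\<bar> * 1 \<le> \<bar>k\<bar> * \<bar>k\<bar>" by (intro mult_left_mono) auto
      then show ?thesis by (simp add: power2_eq_square)
    qed simp
    define S where "S = (\<Sum>l<n. nat \<bar>z l\<bar>)"
    have "int S = (\<Sum>l<n. \<bar>z l\<bar>)" by (simp add: S_def)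
    also have "\<dots> \<le> (\<Sum>l<n. (z l)\<^sup>2)" by (intro sum_mono sq)
    also have "\<dots> \<le> 4 * int n" using z unfolding Z'_def by simp
    finally have "S \<le> 4 * n" by simp
    then have "(1 / 2 :: real) ^ (4 * n) \<le> (1 / 2) ^ S" by (intro power_decreasing) auto
    then have "16 ^ n * (1 / 2 :: real) ^ (4 * n) \<le> 16 ^ n * (\<Prod>l<n. (1 / 2) ^ nat \<bar>z l\<bar>)"
      by (intro mult_left_mono) (auto simp: power_sum S_def)
    moreover have "16 ^ n * (1 / 2 :: real) ^ (4 * n) = (16 * (1 / 2) ^ 4) ^ n"
      by (simp only: power_mult power_mult_distrib)
    moreover have "(16 * (1 / 2 :: real) ^ 4) ^ n = 1" by (simp add: power_divide)
    ultimately show "1 \<le> 16 ^ n * (\<Prod>l<n. (1 / 2 :: real) ^ nat \<bar>z l\<bar>)" by linarith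
  qed
  also have "\<dots> \<le> (\<Sum>z\<in>Z. 16 ^ n * (\<Prod>l<n. (1 / 2) ^ nat \<bar>z l\<bar>))"
    using fin unfolding Z'_def by (intro sum_mono2) (auto intro!: mult_nonneg_nonneg prod_nonneg)
  also have "\<dots> = 16 ^ n * (\<Prod>l<n. \<Sum>k\<in>{- int (2 * n)..int (2 * n)}. (1 / 2) ^ nat \<bar>k\<bar>)"
    unfolding Z_def sum_distrib_left[symmetric] by (subst prod_sum_PiE) auto
  also have "\<dots> \<le> 16 ^ n * (\<Prod>l<n. 3)"
    using sum_half_power_abs_le[of "2 * n"] by (intro mult_left_mono prod_mono) (auto intro: sum_nonneg)
  also have "\<dots> = 48 ^ n" by (simp flip: power_mult_distrib)
  finally show ?thesis .
qed

lemma net_sum_sq_le_1: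
  assumes "y \<in> net n" "n > 0"
  shows "(\<Sum>l<n. (y l)\<^sup>2) \<le> 1"
proof -
  obtain z where z: "y = (\<lambda>l. real_of_int (z l) / (2 * sqrt (real n)))" "(\<Sum>l<n. (z l)\<^sup>2) \<le> 4 * int n"
    using assms unfolding net_def by auto
  have "(\<Sum>l<n. (y l)\<^sup>2) = real_of_int (\<Sum>l<n. (z l)\<^sup>2) / (4 * real n)"
    unfolding z(1) by (simp add: power_divide power_mult_distrib sum_divide_distrib)
  also have "\<dots> \<le> real_of_int (4 * int n) / (4 * real n)"
    using z(2) by (intro divide_right_mono of_int_le_iff[THEN iffD2]) auto
  finally show ?thesis using assms by simp
qed

lemma net_approx:
  assumes n: "n > 0" and x: "(\<Sum>l<n. (x l)\<^sup>2) \<le> 1"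
  obtains y where "y \<in> net n" "\<And>l. l < n \<Longrightarrow> \<bar>x l - y l\<bar> \<le> 1 / (2 * sqrt (real n))"
proof -
  define c where "c = 2 * sqrt (real n)"
  have c: "c > 0" "c\<^sup>2 = 4 * real n" unfolding c_def using n by (auto simp: power_mult_distrib)
  \<comment> \<open>Rounding towards zero keeps the point in the unit ball.\<close>
  define z where "z = (\<lambda>l\<in>{..<n}. if x l \<ge> 0 then \<lfloor>c * x l\<rfloor> else \<lceil>c * x l\<rceil>)"
  have z1: "\<bar>real_of_int (z l)\<bar> \<le> \<bar>c * x l\<bar>" and z2: "\<bar>c * x l - real_of_int (z l)\<bar> \<le> 1" if "l < n" for l
  proof -
    have zl: "z l = (if x l \<ge> 0 then \<lfloor>c * x l\<rfloor> else \<lceil>c * x l\<rceil>)" using that unfolding z_def by simp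
    have "\<bar>real_of_int (z l)\<bar> \<le> \<bar>c * x l\<bar> \<and> \<bar>c * x l - real_of_int (z l)\<bar> \<le> 1"
    proof (cases "x l \<ge> 0")
      case True
      then have "0 \<le> c * x l" using c by simp
      then have "0 \<le> \<lfloor>c * x l\<rfloor>" by simp
      then show ?thesis using True \<open>0 \<le> c * x l\<close> unfolding zl by simp linarith
    next
      case False
      then have neg: "c * x l < 0" using c by (simp add: mult_pos_neg)
      then have "\<lceil>c * x l\<rceil> \<le> 0" by simp
      then show ?thesis using False neg unfolding zl by simp linarith
    qed
    then show "\<bar>real_of_int (z l)\<bar> \<le> \<bar>c * x l\<bar>" "\<bar>c * x l - real_of_int (z l)\<bar> \<le> 1" by auto
  qed
  have "real_of_int (\<Sum>l<n. (z l)\<^sup>2) \<le> (\<Sum>l<n. (c * x l)\<^sup>2)"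
    using z1 by (auto intro!: sum_mono simp: abs_le_square_iff)
  also have "\<dots> = 4 * real n * (\<Sum>l<n. (x l)\<^sup>2)" by (simp add: power_mult_distrib c(2) sum_distrib_left)
  also have "\<dots> \<le> 4 * real n * 1" using x by (intro mult_left_mono) auto
  finally have zs: "(\<Sum>l<n. (z l)\<^sup>2) \<le> 4 * int n" by linarith
  \<comment> \<open>The bound on the sum of squares gives coordinates of size at most 2 sqrt n \<le>
    2n, so the box that makes \<open>net\<close> finite excludes no such point.\<close>
  have zb: "\<bar>z l\<bar> \<le> int (2 * n)" if "l < n" for l
  proof -
    have "(z l)\<^sup>2 \<le> (\<Sum>l<n. (z l)\<^sup>2)" using that by (intro member_le_sum) auto
    also note zs
    also have "4 * int n \<le> 4 * (int n * int n)" using n by simp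
    also have "\<dots> = (int (2 * n))\<^sup>2" by (simp add: power2_eq_square)
    finally have "\<bar>z l\<bar> \<le> \<bar>int (2 * n)\<bar>" by (rule abs_le_square_iff[THEN iffD2])
    then show ?thesis by simp
  qed
  have "z \<in> {..<n} \<rightarrow>\<^sub>E {- int (2 * n)..int (2 * n)}"
  proof (rule PiE_I)
    fix l assume "l \<in> {..<n}"
    then have "\<bar>z l\<bar> \<le> int (2 * n)" by (intro zb) simp
    then show "z l \<in> {- int (2 * n)..int (2 * n)}" by (simp add: abs_le_iff)
  qed (simp add: z_def)
  then have y: "(\<lambda>l. real_of_int (z l) / c) \<in> net n" unfolding net_def c_def using zs by blast
  show ?thesis
  proof (rule that[OF y])
    fix l assume "l < n"
    have "\<bar>x l - real_of_int (z l) / c\<bar> = \<bar>c * x l - real_of_int (z l)\<bar> / c"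
      using c(1) by (simp add: abs_if field_simps)
    also have "\<dots> \<le> 1 / c" using z2[OF \<open>l < n\<close>] c(1) by (intro divide_right_mono) auto
    finally show "\<bar>x l - real_of_int (z l) / c\<bar> \<le> 1 / (2 * sqrt (real n))" unfolding c_def .
  qed
qed

text \<open>The mesh 1/(2 sqrt n) gives a Euclidean error of at most 1/2. Approximating the
  normalised \<open>h\<close> by a net point yields H \<le> B + H/2.\<close>

lemma L2_set_le_of_net:
  assumes n: "n > 0" and b: "\<And>y. y \<in> net n \<Longrightarrow> \<bar>\<Sum>l<n. h l * y l\<bar> \<le> B"
  shows "L2_set h {..<n} \<le> 2 * B"
proof (cases "L2_set h {..<n} = 0")
  case True
  obtain y where "y \<in> net n" using net_approx[OF n, of "\<lambda>_. 0"] by auto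
  then show ?thesis using b[of y] True by linarith
next
  case False
  define H where "H = L2_set h {..<n}"
  have H: "H > 0" using False L2_set_nonneg[of h "{..<n}"] unfolding H_def by linarith
  have H2: "(\<Sum>l<n. (h l)\<^sup>2) = H\<^sup>2" unfolding H_def L2_set_def by (simp add: sum_nonneg)
  have "(\<Sum>l<n. (h l / H)\<^sup>2) = 1" using H H2 by (simp add: power_divide flip: sum_divide_distrib)
  then obtain y where y: "y \<in> net n" "\<And>l. l < n \<Longrightarrow> \<bar>h l / H - y l\<bar> \<le> 1 / (2 * sqrt (real n))"
    using net_approx[OF n, of "\<lambda>l. h l / H"] by auto
  have "H = (\<Sum>l<n. h l * (h l / H))"
    using H H2 by (simp add: power2_eq_square flip: sum_divide_distrib)
  also have "\<dots> = (\<Sum>l<n. h l * y l) + (\<Sum>l<n. h l * (h l / H - y l))"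
    by (simp add: sum.distrib[symmetric] algebra_simps)
  also have "(\<Sum>l<n. h l * (h l / H - y l)) \<le> (\<Sum>l<n. \<bar>h l\<bar> * \<bar>h l / H - y l\<bar>)"
    by (intro sum_mono) (metis abs_ge_self abs_mult)
  also have "\<dots> \<le> H * L2_set (\<lambda>l. h l / H - y l) {..<n}"
    unfolding H_def by (rule L2_set_mult_ineq)
  also have "L2_set (\<lambda>l. h l / H - y l) {..<n} \<le> L2_set (\<lambda>l. 1 / (2 * sqrt (real n))) {..<n}"
    unfolding L2_set_def using y(2) by (intro real_sqrt_le_mono sum_mono) (auto simp: abs_le_square_iff[symmetric])
  also have "\<dots> = 1 / 2" using n by (simp add: L2_set_constant)
  also have "(\<Sum>l<n. h l * y l) \<le> B" using b[OF y(1)] by linarith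
  finally show ?thesis unfolding H_def[symmetric] using H by (simp add: mult_left_mono)
qed

text \<open>A real net suffices for complex vectors: by Cauchy-Schwarz only the norms of the
  \<open>x l\<close> matter, and the real and imaginary parts of \<open>g\<close> contribute 2 * B
  each.\<close>

lemma norm_linear_le_of_net:
  fixes g x :: "nat \<Rightarrow> complex"
  assumes n: "n > 0" and b: "\<And>y. y \<in> net n \<Longrightarrow> norm (\<Sum>l<n. g l * of_real (y l)) \<le> B"
    and x: "(\<Sum>l<n. (norm (x l))\<^sup>2) \<le> 1"
  shows "norm (\<Sum>l<n. g l * x l) \<le> 4 * B"
proof -
  have xs: "L2_set (\<lambda>l. norm (x l)) {..<n} \<le> 1" unfolding L2_set_def using x by simp
  have part: "(\<Sum>l<n. \<bar>h l\<bar> * \<bar>norm (x l)\<bar>) \<le> 2 * B"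
    if "\<And>y. y \<in> net n \<Longrightarrow> \<bar>\<Sum>l<n. h l * y l\<bar> \<le> B" for h
  proof -
    have "(\<Sum>l<n. \<bar>h l\<bar> * \<bar>norm (x l)\<bar>) \<le> L2_set h {..<n} * L2_set (\<lambda>l. norm (x l)) {..<n}"
      by (rule L2_set_mult_ineq)
    also have "\<dots> \<le> L2_set h {..<n} * 1" using xs by (intro mult_left_mono) auto
    finally show ?thesis using L2_set_le_of_net[OF n that] by simp
  qed
  have re: "\<bar>\<Sum>l<n. Re (g l) * y l\<bar> \<le> B" and im: "\<bar>\<Sum>l<n. Im (g l) * y l\<bar> \<le> B" if "y \<in> net n" for y
    using b[OF that] abs_Re_le_cmod[of "\<Sum>l<n. g l * of_real (y l)"] abs_Im_le_cmod[of "\<Sum>l<n. g l * of_real (y l)"]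
    by auto
  have "norm (\<Sum>l<n. g l * x l) \<le> (\<Sum>l<n. norm (g l) * norm (x l))"
    by (rule order_trans[OF norm_sum]) (simp add: norm_mult)
  also have "\<dots> \<le> (\<Sum>l<n. \<bar>Re (g l)\<bar> * \<bar>norm (x l)\<bar> + \<bar>Im (g l)\<bar> * \<bar>norm (x l)\<bar>)"
    unfolding distrib_right[symmetric] by (intro sum_mono mult_mono cmod_le) auto
  also have "\<dots> \<le> 2 * B + 2 * B"
    unfolding sum.distrib using re im by (intro add_mono part)
  finally show ?thesis by simp
qed

text \<open>The bound cosh a \<le> exp(a^2), weaker than the one with a^2/2 but elementary:
  quadratic estimates for |a| \<le> 1, and |a| \<le> a^2 beyond.\<close>

lemma exp_add_exp_minus_le: "exp (- a) + exp a \<le> 2 * exp ((a::real)\<^sup>2)"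
proof -
  have "exp (- a) + exp a \<le> 2 * exp (a\<^sup>2)" if a: "0 \<le> a" for a :: real
  proof (cases "a \<le> 1")
    case True
    have e1: "exp a \<le> 1 + a + a\<^sup>2" using a True by (rule exp_bound)
    have "exp (- a) = 1 / exp a" by (simp add: exp_minus field_simps)
    also have "\<dots> \<le> 1 / (1 + a)" using a exp_ge_add_one_self[of a] by (intro divide_left_mono) auto
    also have "\<dots> \<le> 1 - a + a\<^sup>2"
    proof -
      have "1 \<le> (1 - a + a\<^sup>2) * (1 + a)" using a by (simp add: power2_eq_square algebra_simps)
      then show ?thesis using a by (simp add: pos_divide_le_eq)
    qed
    finally have "exp (- a) + exp a \<le> 2 * (1 + a\<^sup>2)" using e1 by simp
    also have "\<dots> \<le> 2 * exp (a\<^sup>2)" by (intro mult_left_mono exp_ge_add_one_self) simp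
    finally show ?thesis .
  next
    case False
    then have "a * 1 \<le> a * a" using a by (intro mult_left_mono) auto
    then have "exp a \<le> exp (a\<^sup>2)" by (simp add: power2_eq_square)
    moreover have "exp (- a) \<le> exp a" using a by simp
    ultimately show ?thesis by linarith
  qed
  from this[of "\<bar>a\<bar>"] show ?thesis by (cases "0 \<le> a") (auto simp: add.commute)
qed

text \<open>The exponential turns the sum into a product over independent signs, so the sum over all
  sign choices factors.\<close>

lemma sum_signs_exp_le:
  assumes "finite L"
  shows "(\<Sum>g\<in>signs L. exp (c * (\<Sum>l\<in>L. g l * a l))) \<le> 2 ^ card L * exp (c\<^sup>2 * (\<Sum>l\<in>L. (a l)\<^sup>2))"
proof -
  have "(\<Sum>g\<in>signs L. exp (c * (\<Sum>l\<in>L. g l * a l))) = (\<Sum>g\<in>signs L. \<Prod>l\<in>L. exp (g l * (c * a l)))"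
    using assms by (simp add: sum_distrib_left exp_sum mult_ac)
  also have "\<dots> = (\<Prod>l\<in>L. \<Sum>s\<in>{-1, 1}. exp (s * (c * a l)))"
    unfolding signs_def using assms by (intro prod_sum_PiE[symmetric]) auto
  also have "\<dots> \<le> (\<Prod>l\<in>L. 2 * exp ((c * a l)\<^sup>2))"
    using exp_add_exp_minus_le by (intro prod_mono) auto
  also have "\<dots> = 2 ^ card L * exp (c\<^sup>2 * (\<Sum>l\<in>L. (a l)\<^sup>2))"
    using assms by (simp add: prod.distrib exp_sum sum_distrib_left power_mult_distrib)
  finally show ?thesis .
qed

lemma signs_abs: "g \<in> signs L \<Longrightarrow> l \<in> L \<Longrightarrow> \<bar>g l\<bar> = 1"
  unfolding signs_def by (drule PiE_mem) auto

text \<open>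
  Union bound with exponential moments at scale \<open>\<surd>n\<close>: the net has at most \<open>48\<^sup>n \<le> exp (47 n)\<close> points,
  which is where the constant \<open>47 m + 2\<close> comes from.
\<close>
lemma exists_signs_small_on_net:
  assumes n: "n > 0"
  shows "\<exists>t\<in>signs (idx m n). \<forall>y\<in>{..<m} \<rightarrow>\<^sub>E net n.
    \<bar>array_form m n t y\<bar> \<le> (47 * real m + 2) * sqrt (real n)"
proof (rule ccontr)
  define c where "c = sqrt (real n)"
  define B where "B = (47 * real m + 2) * c"
  have c: "c > 0" "c\<^sup>2 = real n" "c * c = real n" unfolding c_def using n by auto
  let ?Y = "{..<m} \<rightarrow>\<^sub>E net n" and ?S = "signs (idx m n)"
  define E where "E t y = exp (c * array_form m n t y) + exp (- c * array_form m n t y)" for t y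
  assume "\<not> (\<exists>t\<in>?S. \<forall>y\<in>?Y. \<bar>array_form m n t y\<bar> \<le> (47 * real m + 2) * sqrt (real n))"
  then have neg: "\<exists>y\<in>?Y. \<bar>array_form m n t y\<bar> > B" if "t \<in> ?S" for t
    using that unfolding B_def c_def by (meson not_le)
  have finY: "finite ?Y" using finite_net by (intro finite_PiE) auto
  have S: "finite ?S" "card ?S = 2 ^ card (idx m n)" using finite_idx by (auto simp: finite_signs card_signs)
  have E0: "0 \<le> E t y" for t y unfolding E_def by simp
  have low: "exp (c * B) < (\<Sum>y\<in>?Y. E t y)" if t: "t \<in> ?S" for t
  proof -
    obtain y where y: "y \<in> ?Y" "\<bar>array_form m n t y\<bar> > B" using neg[OF t] by blast
    have "exp (c * B) < exp (c * \<bar>array_form m n t y\<bar>)" using y c by simp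
    also have "\<dots> \<le> E t y" unfolding E_def by (cases "0 \<le> array_form m n t y") auto
    also have "\<dots> \<le> (\<Sum>y\<in>?Y. E t y)" using y finY E0 by (intro member_le_sum) auto
    finally show ?thesis .
  qed
  have up: "(\<Sum>t\<in>?S. E t y) \<le> 2 * (2 ^ card (idx m n) * exp (real n))" if y: "y \<in> ?Y" for y
  proof -
    define a where "a j = (\<Prod>i<m. y i (j i))" for j
    \<comment> \<open>For fixed \<open>y\<close> the form is a Rademacher sum in \<open>t\<close>
      with coefficients \<open>a j\<close>; its variance factors into the squared Euclidean norms of
      the \<open>y i\<close>.\<close>
    have "(\<Sum>j\<in>idx m n. (a j)\<^sup>2) = (\<Prod>i<m. \<Sum>l<n. (y i l)\<^sup>2)"
      unfolding a_def prod_power_distrib by (intro prod_sum_PiE[symmetric]) auto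
    also have "\<dots> \<le> 1"
      using PiE_mem[OF y] n by (intro prod_le_1) (auto intro: net_sum_sq_le_1 sum_nonneg)
    finally have a: "(\<Sum>j\<in>idx m n. (a j)\<^sup>2) \<le> 1" .
    have one: "(\<Sum>t\<in>?S. exp (d * array_form m n t y)) \<le> 2 ^ card (idx m n) * exp (real n)"
      if d: "d\<^sup>2 = real n" for d
    proof -
      have "(\<Sum>t\<in>?S. exp (d * array_form m n t y)) \<le> 2 ^ card (idx m n) * exp (d\<^sup>2 * (\<Sum>j\<in>idx m n. (a j)\<^sup>2))"
        unfolding array_form_def a_def[symmetric] by (rule sum_signs_exp_le[OF finite_idx])
      also have "\<dots> \<le> 2 ^ card (idx m n) * exp (d\<^sup>2 * 1)"
        using a by (intro mult_left_mono) (auto intro!: mult_left_le)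
      finally show ?thesis using d by simp
    qed
    show ?thesis using one[of c] one[of "- c"] c unfolding E_def sum.distrib by simp
  qed
  \<comment> \<open>The factor 2 from the two signs of \<open>c\<close> is absorbed into a second
    \<open>exp (real n)\<close>; together with the one from the moment bound this accounts for the 2
    in \<open>47 * real m + 2\<close>.\<close>
  have "2 \<le> 1 + real n" using n by simp
  also have "\<dots> \<le> exp (real n)" by (rule exp_ge_add_one_self)
  finally have two: "2 \<le> exp (real n)" .
  have "real (card ?Y) = real (card (net n)) ^ m" by (simp add: card_PiE)
  also have "\<dots> \<le> (48 ^ n) ^ m" using card_net by (intro power_mono) auto
  also have "\<dots> = 48 ^ (n * m)" by (simp add: power_mult)
  also have "\<dots> \<le> exp 47 ^ (n * m)" using exp_ge_add_one_self[of 47] by (intro power_mono) auto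
  also have "\<dots> = exp (47 * (real n * real m))" by (simp flip: exp_of_nat_mult)
  finally have cardY: "real (card ?Y) \<le> exp (47 * (real n * real m))" .
  have "2 ^ card (idx m n) * exp (c * B) = (\<Sum>t\<in>?S. exp (c * B))" using S by simp
  also have "\<dots> < (\<Sum>t\<in>?S. \<Sum>y\<in>?Y. E t y)"
  proof (rule sum_strict_mono[OF S(1) _ low])
    show "?S \<noteq> {}" using S(2) by (intro notI) simp
  qed
  also have "\<dots> = (\<Sum>y\<in>?Y. \<Sum>t\<in>?S. E t y)" by (rule sum.swap)
  also have "\<dots> \<le> (\<Sum>y\<in>?Y. 2 * (2 ^ card (idx m n) * exp (real n)))" using up by (rule sum_mono)
  also have "\<dots> = real (card ?Y) * (2 * (2 ^ card (idx m n) * exp (real n)))" by simp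
  also have "\<dots> \<le> exp (47 * (real n * real m)) * (exp (real n) * (2 ^ card (idx m n) * exp (real n)))"
    using cardY two by (intro mult_mono) auto
  also have "\<dots> = 2 ^ card (idx m n) * exp (47 * (real n * real m) + real n + real n)"
    by (simp only: exp_add mult_ac)
  also have "47 * (real n * real m) + real n + real n = c * B"
  proof -
    have "c * B = (47 * real m + 2) * (c * c)" unfolding B_def by (simp only: mult_ac)
    then show ?thesis unfolding c(3) by (simp add: algebra_simps)
  qed
  finally show False by simp
qed

lemma array_form_of_real:
  "array_form m n (\<lambda>j. complex_of_real (t j)) (\<lambda>i l. complex_of_real (x i l)) = complex_of_real (array_form m n t x)"
  unfolding array_form_def by simp

lemma norm_array_form_le_of_net:
  fixes t :: "(nat \<Rightarrow> nat) \<Rightarrow> complex"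
  assumes n: "n > 0" and b: "\<And>y. (\<And>i. i < m \<Longrightarrow> y i \<in> net n) \<Longrightarrow> norm (array_form m n t (\<lambda>i l. of_real (y i l))) \<le> B"
    and x: "\<And>i. i < m \<Longrightarrow> (\<Sum>l<n. (norm (x i l))\<^sup>2) \<le> 1"
  shows "norm (array_form m n t x) \<le> 4 ^ m * B"
proof -
  \<comment> \<open>Release the variables from the net one at a time, at the cost of a factor 4 each.\<close>
  have step: "norm (array_form m n t (\<lambda>i. if i < k then x i else (\<lambda>l. of_real (y i l)))) \<le> 4 ^ k * B"
    if "k \<le> m" "\<And>i. i < m \<Longrightarrow> y i \<in> net n" for k y
    using that
  proof (induction k arbitrary: y)
    case 0
    then show ?case using b by simp
  next
    case (Suc k)
    have k: "k < m" using Suc by simp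
    define w where "w = (\<lambda>i. if i < Suc k then x i else (\<lambda>l. complex_of_real (y i l)))"
    define G where "G l = (\<Sum>j\<in>({..<m} - {k}) \<rightarrow>\<^sub>E {..<n}. t (j(k := l)) * (\<Prod>i\<in>{..<m} - {k}. w i (j i)))" for l
    have Gw: "array_form m n t (w(k := v)) = (\<Sum>l<n. G l * v l)" for v
      unfolding array_form_split[OF k] G_def by (simp add: mult.commute)
    have "norm (\<Sum>l<n. G l * w k l) \<le> 4 * (4 ^ k * B)"
    proof (rule norm_linear_le_of_net[OF n])
      show "(\<Sum>l<n. (norm (w k l))\<^sup>2) \<le> 1" using x[OF k] unfolding w_def by simp
      fix z assume z: "z \<in> net n"
      have "w(k := (\<lambda>l. of_real (z l))) = (\<lambda>i. if i < k then x i else (\<lambda>l. of_real ((y(k := z)) i l)))"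
        unfolding w_def by (auto simp: fun_eq_iff less_Suc_eq)
      moreover have "norm (array_form m n t (\<lambda>i. if i < k then x i else (\<lambda>l. of_real ((y(k := z)) i l)))) \<le> 4 ^ k * B"
        using Suc.prems z by (intro Suc.IH) auto
      ultimately show "norm (\<Sum>l<n. G l * of_real (z l)) \<le> 4 ^ k * B"
        using Gw[of "\<lambda>l. of_real (z l)"] by simp
    qed
    moreover have "w(k := w k) = w" by simp
    ultimately show ?case using Gw[of "w k"] unfolding w_def by simp
  qed
  obtain y0 where y0: "y0 \<in> net n" using net_approx[OF n, of "\<lambda>_. 0"] by auto
  have "norm (array_form m n t (\<lambda>i. if i < m then x i else (\<lambda>l. of_real (y0 l)))) \<le> 4 ^ m * B"
    using step[of m "\<lambda>_. y0"] y0 by simp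
  also have "array_form m n t (\<lambda>i. if i < m then x i else (\<lambda>l. of_real (y0 l))) = array_form m n t x"
    unfolding array_form_def by simp
  finally show ?thesis .
qed

text \<open>The net argument is run once, over the complex numbers; the real bound is its
  restriction to real vectors.\<close>

lemma exists_unimodular_small_form:
  assumes n: "n > 0"
  obtains t :: "(nat \<Rightarrow> nat) \<Rightarrow> real" where "\<And>j. j \<in> idx m n \<Longrightarrow> \<bar>t j\<bar> = 1"
    "form_bound (ereal 2) m n (\<lambda>j. complex_of_real (t j)) (4 ^ m * ((47 * real m + 2) * sqrt (real n)))"
    "form_bound (ereal 2) m n t (4 ^ m * ((47 * real m + 2) * sqrt (real n)))"
proof -
  define B where "B = (47 * real m + 2) * sqrt (real n)"
  obtain t where t: "t \<in> signs (idx m n)" and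
    tb: "\<And>y. y \<in> {..<m} \<rightarrow>\<^sub>E net n \<Longrightarrow> \<bar>array_form m n t y\<bar> \<le> B"
    using exists_signs_small_on_net[OF n, of m] unfolding B_def by blast
  have cb: "form_bound (ereal 2) m n (\<lambda>j. complex_of_real (t j)) (4 ^ m * B)"
    unfolding form_bound_def
  proof (intro allI impI norm_array_form_le_of_net[OF n])
    fix x :: "nat \<Rightarrow> nat \<Rightarrow> complex" and i assume "\<forall>i<m. in_ball (ereal 2) n (x i)" "i < m"
    then show "(\<Sum>l<n. (norm (x i l))\<^sup>2) \<le> 1" unfolding in_ball_def by (simp add: powr_numeral)
  next
    fix y :: "nat \<Rightarrow> nat \<Rightarrow> real" assume "\<And>i. i < m \<Longrightarrow> y i \<in> net n"
    then have "restrict y {..<m} \<in> {..<m} \<rightarrow>\<^sub>E net n" by (simp only: restrict_PiE_iff) simp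
    from tb[OF this] have "\<bar>array_form m n t y\<bar> \<le> B" unfolding array_form_def by simp
    then show "norm (array_form m n (\<lambda>j. complex_of_real (t j)) (\<lambda>i l. complex_of_real (y i l))) \<le> B"
      unfolding array_form_of_real by simp
  qed
  moreover have "form_bound (ereal 2) m n t (4 ^ m * B)"
    unfolding form_bound_def
  proof (intro allI impI)
    fix x :: "nat \<Rightarrow> nat \<Rightarrow> real" assume x: "\<forall>i<m. in_ball (ereal 2) n (x i)"
    have "norm (array_form m n (\<lambda>j. complex_of_real (t j)) (\<lambda>i l. complex_of_real (x i l))) \<le> 4 ^ m * B"
      using x by (intro cb[unfolded form_bound_def, rule_format]) (simp add: in_ball_def)
    then show "norm (array_form m n t x) \<le> 4 ^ m * B" unfolding array_form_of_real by simp
  qed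
  ultimately show ?thesis using that signs_abs[OF t] unfolding B_def by blast
qed

text \<open>The coefficient norm is n^(m/r), while the norm on l_p-balls is of order at most
  n^(m(1/2 - 1/p)) sqrt n by inclusion in l_2-balls; comparing powers of n gives the bound on
  s.\<close>

lemma hardy_littlewood_exponent_random:
  assumes h: "hardy_littlewood_ineq TYPE('a::real_normed_field) m r p s" and p: "2 \<le> p" and r: "0 < r"
    and ex: "\<And>n. n > 0 \<Longrightarrow> \<exists>t :: (nat \<Rightarrow> nat) \<Rightarrow> 'a. (\<forall>j\<in>idx m n. norm (t j) = 1) \<and>
      form_bound (ereal 2) m n t (4 ^ m * ((47 * real m + 2) * sqrt (real n)))"
  shows "real m / r + real m * inv_exponent p - real m / 2 - 1 / 2 \<le> s"
proof -
  have p0: "0 < p" using p by (rule less_le_trans[rotated]) simp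
  obtain D where D: "D > 0" and H: "\<And>n (t :: (nat \<Rightarrow> nat) \<Rightarrow> 'a) B. n > 0 \<Longrightarrow> form_bound p m n t B \<Longrightarrow>
    (\<Sum>j\<in>idx m n. norm (t j) powr r) powr (1 / r) \<le> D * real n powr s * B"
    using array_of_hardy_littlewood[OF h p0] by blast
  define K where "K = 4 ^ m * (47 * real m + 2)"
  have K: "K > 0" unfolding K_def by (simp add: add_nonneg_pos)
  define d where "d = real m * (1 / 2 - inv_exponent p)"
  have key: "real n powr (real m / r) \<le> (D * K) * real n powr (s + d + 1 / 2)" if n: "n > 0" for n
  proof -
    obtain t :: "(nat \<Rightarrow> nat) \<Rightarrow> 'a" where t: "\<And>j. j \<in> idx m n \<Longrightarrow> norm (t j) = 1"
      and b: "form_bound (ereal 2) m n t (K * sqrt (real n))"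
      using ex[OF n] unfolding K_def by (auto simp: mult.assoc)
    have "form_bound p m n t (real n powr d * (K * sqrt (real n)))"
      unfolding d_def using form_bound_change_p[OF b _ _ n, of p] p by simp
    from H[OF n this] have "(\<Sum>j\<in>idx m n. norm (t j) powr r) powr (1 / r) \<le> D * real n powr s * (real n powr d * (K * sqrt (real n)))" .
    also have "(\<Sum>j\<in>idx m n. norm (t j) powr r) = real n ^ m" using t card_idx[of m n] by simp
    also have "(real n ^ m) powr (1 / r) = real n powr (real m / r)"
      using n by (simp add: powr_powr flip: powr_realpow)
    also have "D * real n powr s * (real n powr d * (K * sqrt (real n))) = D * K * real n powr (s + d + 1 / 2)"
      unfolding powr_add using n by (simp add: powr_half_sqrt)
    finally show ?thesis .
  qed
  have "0 < D * K" using D K by simp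
  from exponent_le_of_bound[OF this key] have "real m / r \<le> s + d + 1 / 2" .
  then show ?thesis unfolding d_def by (simp add: algebra_simps)
qed

subsection \<open>The exponents of the theorem\<close>

lemma exponent_a_eq:
  assumes "0 < r" "2 \<le> p"
  shows "exponent_a m r p = max (real m / r + real m * inv_exponent p - real m / 2 - 1 / 2) 0"
proof (cases "p = \<infinity>")
  case True
  have "(2 * real m - real m * r - r) / (2 * r) = real m / r - real m / 2 - 1 / 2"
    using assms(1) by (simp add: field_simps)
  then show ?thesis using True unfolding exponent_a_def inv_exponent_def by simp
next
  case False
  then obtain q where q: "p = ereal q" using assms by (cases p) auto
  then have q0: "q > 0" using assms(2) by (simp add: numeral_eq_ereal)
  have "(2 * real m * r + 2 * real m * q - real m * q * r - q * r) / (2 * q * r)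
      = real m / r + real m * (1 / q) - real m / 2 - 1 / 2"
    using assms(1) q0 by (simp add: field_simps)
  then show ?thesis using q unfolding exponent_a_def inv_exponent_def by (simp add: Let_def)
qed

lemma exponent_b_eq:
  assumes "0 < r" "0 < p"
  shows "exponent_b m r p = max (1 / r + real m / p - 1) 0"
  using assms unfolding exponent_b_def by (simp add: field_simps)

text \<open>For p \<ge> 2m the critical exponent is 1/u and \<open>E = m (1/r - u)\<close>, so the
  sign of \<open>E\<close> decides whether r is raised for free or lowered at cost \<open>E\<close>.
  For p < 2m the start is the pair (2, 2m), which has exponent 0; lowering r and then p costs
  \<open>E\<close> in total.\<close>

lemma array_ineq_exponent_a:
  assumes m: "m \<ge> 2" and c: "1 \<le> r \<and> r \<le> 2 \<and> 2 \<le> p \<and> p < ereal (2 * real m) \<or> 1 \<le> r \<and> ereal (2 * real m) \<le> p"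
  shows "array_ineq m r p (exponent_a m r p)"
proof -
  have r: "1 \<le> r" using c by blast
  have m4: "(4::real) \<le> 2 * real m" using m by simp
  have "2 \<le> ereal (2 * real m)" using m4 by (simp add: numeral_eq_ereal)
  then have p2: "2 \<le> p" using c order_trans by blast
  define E where "E = real m / r + real m * inv_exponent p - real m / 2 - 1 / 2"
  have Ea: "exponent_a m r p = max E 0" unfolding E_def using r p2 by (intro exponent_a_eq) auto
  show ?thesis
  proof (cases "ereal (2 * real m) \<le> p")
    case True
    define u where "u = (real m + 1) / (2 * real m) - inv_exponent p"
    have ip: "inv_exponent p \<le> 1 / (2 * real m)"
    proof (cases "p = \<infinity>")
      case False
      then obtain x where "p = ereal x" using True by (cases p) auto
      then show ?thesis using True m unfolding inv_exponent_def by (simp add: frac_le)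
    qed (simp add: inv_exponent_def)
    have "(real m + 1) / (2 * real m) = 1 / 2 + 1 / (2 * real m)" using m by (simp add: field_simps)
    then have u: "u > 0" using ip unfolding u_def by simp
    have base: "array_ineq m (1 / u) p 0"
    proof (cases "p = \<infinity>")
      case True
      then show ?thesis using array_ineq_PInf[of m] m unfolding u_def inv_exponent_def by simp
    next
      case False
      then obtain x where "p = ereal x" using True by (cases p) auto
      then show ?thesis using True array_ineq_ge_2m[of m x] m unfolding u_def inv_exponent_def by simp
    qed
    have E: "E = real m * (1 / r - u)" unfolding E_def u_def using m by (simp add: field_simps)
    show ?thesis
    proof (cases "1 / u \<le> r")
      case True
      then have "1 / r \<le> u" using u r by (simp add: field_simps)
      then have "E \<le> 0" unfolding E by (simp add: mult_nonneg_nonpos)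
      then show ?thesis using array_ineq_increase_r[OF base _ True] u unfolding Ea by (simp add: max_def)
    next
      case False
      then have "u \<le> 1 / r" using u r by (simp add: field_simps)
      then have "E \<ge> 0" unfolding E by simp
      then show ?thesis using array_ineq_decrease_r[OF base, of r] False r unfolding Ea E by simp
    qed
  next
    case False
    then have c': "r \<le> 2" "p < ereal (2 * real m)" using c by auto
    then obtain x where x: "p = ereal x" using p2 by (cases p) auto
    have x2: "2 \<le> x" "x < 2 * real m" using p2 c' unfolding x by (auto simp: numeral_eq_ereal)
    have "array_ineq m (1 / ((real m + 1) / (2 * real m) - 1 / (2 * real m))) (ereal (2 * real m)) 0"
      using m by (intro array_ineq_ge_2m) auto
    moreover have "1 / ((real m + 1) / (2 * real m) - 1 / (2 * real m)) = 2" using m by (simp add: field_simps)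
    ultimately have "array_ineq m 2 (ereal (2 * real m)) 0" by simp
    from array_ineq_decrease_r[OF this, of r]
    have "array_ineq m r (ereal (2 * real m)) (0 + real m * (1 / r - 1 / 2))" using r c' by simp
    from array_ineq_decrease_p[OF this, of x]
    have "array_ineq m r (ereal x) (0 + real m * (1 / r - 1 / 2) + real m * (1 / x - inv_exponent (ereal (2 * real m))))"
      using r x2 by simp
    also have "0 + real m * (1 / r - 1 / 2) + real m * (1 / x - inv_exponent (ereal (2 * real m))) = E"
      unfolding E_def x inv_exponent_def using m by (simp add: algebra_simps)
    finally have ok: "array_ineq m r (ereal x) E" .
    have "real m / r \<ge> real m / 2" using c' r m by (intro divide_left_mono) auto
    moreover have "real m / x \<ge> real m / (2 * real m)" using x2 m by (intro divide_left_mono) auto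
    ultimately have "E \<ge> 0" unfolding E_def x inv_exponent_def using m by simp
    then show ?thesis using ok Ea unfolding x by simp
  qed
qed

text \<open>Below the critical exponent p/(p-m), the value \<open>p' = m r / (r - 1)\<close> solves
  p'/(p'-m) = r, so the inequality holds at p' with exponent 0. As m/p' = 1 - 1/r, lowering p' to p
  costs exactly 1/r + m/p - 1. The hypothesis r \<ge> 2 ensures p' \<le> 2m.\<close>

lemma array_ineq_exponent_b:
  assumes m: "m \<ge> 2" and r: "2 \<le> r" and p: "real m < p" "p \<le> 2 * real m"
  shows "array_ineq m r (ereal p) (exponent_b m r p)"
proof -
  have p0: "0 < p" using p m by linarith
  have Eb: "exponent_b m r p = max (1 / r + real m / p - 1) 0" using r p0 by (intro exponent_b_eq) auto
  show ?thesis
  proof (cases "p / (p - real m) \<le> r")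
    case True
    have "1 / r \<le> 1 / (p / (p - real m))" using True r p p0 by (intro divide_left_mono mult_pos_pos divide_pos_pos) auto
    also have "\<dots> = 1 - real m / p" using p p0 by (simp add: field_simps)
    finally have "exponent_b m r p = 0" unfolding Eb by simp
    then show ?thesis using array_ineq_increase_r[OF array_ineq_le_2m[OF p] _ True] p p0 by simp
  next
    case False
    define p' where "p' = real m * r / (r - 1)"
    have r1: "r < p / (p - real m)" using False by simp
    have "r * (p - real m) < p" using r1 p by (simp add: pos_less_divide_eq)
    then have le: "p \<le> p'" unfolding p'_def using r by (simp add: pos_le_divide_eq algebra_simps)
    have "real m * r \<le> real m * (2 * (r - 1))" using r by (intro mult_left_mono) auto
    then have le2: "p' \<le> 2 * real m" unfolding p'_def using r by (simp add: pos_divide_le_eq algebra_simps)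
    have "array_ineq m (p' / (p' - real m)) (ereal p') 0"
      using p le le2 by (intro array_ineq_le_2m) auto
    moreover have "p' / (p' - real m) = r"
    proof -
      have "p' - real m = real m / (r - 1)" unfolding p'_def using r by (simp add: field_simps)
      then show ?thesis unfolding p'_def using r m by simp
    qed
    ultimately have "array_ineq m r (ereal p') 0" by simp
    from array_ineq_decrease_p[OF this, of p]
    have "array_ineq m r (ereal p) (0 + real m * (1 / p - inv_exponent (ereal p')))" using r p0 le by simp
    also have "0 + real m * (1 / p - inv_exponent (ereal p')) = 1 / r + real m / p - 1"
      unfolding inv_exponent_def p'_def using r m by (simp add: field_simps)
    finally have ok: "array_ineq m r (ereal p) (1 / r + real m / p - 1)" .
    have "1 / (p / (p - real m)) \<le> 1 / r" using r1 r p p0 by (intro divide_left_mono mult_pos_pos divide_pos_pos) auto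
    then have "1 - real m / p \<le> 1 / r" using p p0 by (simp add: field_simps)
    then have "max (1 / r + real m / p - 1) 0 = 1 / r + real m / p - 1" by (intro max_absorb1) simp
    then show ?thesis using ok unfolding Eb by (simp only:)
  qed
qed

lemma optimal_exponent_a:
  assumes m: "m > 0" and r: "1 \<le> r" and p: "2 \<le> p"
    and ex: "\<And>n. n > 0 \<Longrightarrow> \<exists>t :: (nat \<Rightarrow> nat) \<Rightarrow> 'a::real_normed_field. (\<forall>j\<in>idx m n. norm (t j) = 1) \<and>
      form_bound (ereal 2) m n t (4 ^ m * ((47 * real m + 2) * sqrt (real n)))"
  shows "optimal_exponent TYPE('a) m r p (exponent_a m r p)"
  unfolding optimal_exponent_def
proof (intro allI impI)
  fix s assume h: "hardy_littlewood_ineq TYPE('a) m r p s"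
  have p0: "0 < p" using p by (rule less_le_trans[rotated]) simp
  have r0: "0 < r" using r by simp
  show "exponent_a m r p \<le> s"
    unfolding exponent_a_eq[OF r0 p]
    using hardy_littlewood_exponent_random[OF h p r0 ex] hardy_littlewood_exponent_nonneg[OF h p0 r0 m]
    by simp
qed

lemma optimal_exponent_b:
  assumes m: "m > 0" and r: "2 \<le> r" and p: "real m < p"
  shows "optimal_exponent TYPE('a::real_normed_field) m r (ereal p) (exponent_b m r p)"
  unfolding optimal_exponent_def
proof (intro allI impI)
  fix s assume h: "hardy_littlewood_ineq TYPE('a) m r (ereal p) s"
  have p0: "0 < p" "0 < ereal p" "real m \<le> p" using p m by auto
  have r0: "0 < r" using r by simp
  show "exponent_b m r p \<le> s"
    unfolding exponent_b_eq[OF r0 p0(1)]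
    using hardy_littlewood_exponent_diagonal[OF h p0(3) r0 m] hardy_littlewood_exponent_nonneg[OF h p0(2) r0 m]
    by simp
qed

theorem theorem1p1:
  fixes m :: nat
  assumes "m \<ge> 2"
  shows
    "(\<forall>(r::real) (p::ereal).
        (1 \<le> r \<and> r \<le> 2 \<and> 2 \<le> p \<and> p < ereal (2 * real m)) \<or>
        (1 \<le> r \<and> ereal (2 * real m) \<le> p) \<longrightarrow>
          hardy_littlewood_ineq TYPE(real) m r p (exponent_a m r p) \<and>
          optimal_exponent TYPE(real) m r p (exponent_a m r p) \<and>
          hardy_littlewood_ineq TYPE(complex) m r p (exponent_a m r p) \<and>
          optimal_exponent TYPE(complex) m r p (exponent_a m r p)) \<and>
     (\<forall>(r::real) (p::real).
        2 \<le> r \<and> real m < p \<and> p \<le> 2 * real m \<longrightarrow>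
          hardy_littlewood_ineq TYPE(real) m r (ereal p) (exponent_b m r p) \<and>
          optimal_exponent TYPE(real) m r (ereal p) (exponent_b m r p) \<and>
          hardy_littlewood_ineq TYPE(complex) m r (ereal p) (exponent_b m r p) \<and>
          optimal_exponent TYPE(complex) m r (ereal p) (exponent_b m r p))"
proof -
  have m: "m > 0" using assms by simp
  have ex_real: "\<exists>t :: (nat \<Rightarrow> nat) \<Rightarrow> real. (\<forall>j\<in>idx m n. norm (t j) = 1) \<and>
      form_bound (ereal 2) m n t (4 ^ m * ((47 * real m + 2) * sqrt (real n)))"
    and ex_complex: "\<exists>t :: (nat \<Rightarrow> nat) \<Rightarrow> complex. (\<forall>j\<in>idx m n. norm (t j) = 1) \<and>
      form_bound (ereal 2) m n t (4 ^ m * ((47 * real m + 2) * sqrt (real n)))" if n: "n > 0" for n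
  proof -
    obtain t :: "(nat \<Rightarrow> nat) \<Rightarrow> real" where t: "\<And>j. j \<in> idx m n \<Longrightarrow> \<bar>t j\<bar> = 1"
      "form_bound (ereal 2) m n (\<lambda>j. complex_of_real (t j)) (4 ^ m * ((47 * real m + 2) * sqrt (real n)))"
      "form_bound (ereal 2) m n t (4 ^ m * ((47 * real m + 2) * sqrt (real n)))"
      using exists_unimodular_small_form[OF n] by blast
    show "\<exists>t :: (nat \<Rightarrow> nat) \<Rightarrow> real. (\<forall>j\<in>idx m n. norm (t j) = 1) \<and>
        form_bound (ereal 2) m n t (4 ^ m * ((47 * real m + 2) * sqrt (real n)))"
      using t by (intro exI[of _ t]) simp
    show "\<exists>t :: (nat \<Rightarrow> nat) \<Rightarrow> complex. (\<forall>j\<in>idx m n. norm (t j) = 1) \<and>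
        form_bound (ereal 2) m n t (4 ^ m * ((47 * real m + 2) * sqrt (real n)))"
      using t by (intro exI[of _ "\<lambda>j. complex_of_real (t j)"]) simp
  qed
  have "hardy_littlewood_ineq TYPE(real) m r p (exponent_a m r p) \<and>
      optimal_exponent TYPE(real) m r p (exponent_a m r p) \<and>
      hardy_littlewood_ineq TYPE(complex) m r p (exponent_a m r p) \<and>
      optimal_exponent TYPE(complex) m r p (exponent_a m r p)"
    if c: "1 \<le> r \<and> r \<le> 2 \<and> 2 \<le> p \<and> p < ereal (2 * real m) \<or> 1 \<le> r \<and> ereal (2 * real m) \<le> p" for r p
  proof -
    have r: "1 \<le> r" "0 < r" using c by auto
    have "2 \<le> ereal (2 * real m)" using assms by (simp add: numeral_eq_ereal)
    then have p: "2 \<le> p" using c order_trans by blast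
    then have p0: "0 < p" by (rule less_le_trans[rotated]) simp
    show ?thesis
      using hardy_littlewood_real[OF array_ineq_exponent_a[OF assms c] r(2) p0]
        hardy_littlewood_complex[OF array_ineq_exponent_a[OF assms c] r(2) p0]
        optimal_exponent_a[OF m r(1) p ex_real] optimal_exponent_a[OF m r(1) p ex_complex]
      by blast
  qed
  moreover have "hardy_littlewood_ineq TYPE(real) m r (ereal p) (exponent_b m r p) \<and>
      optimal_exponent TYPE(real) m r (ereal p) (exponent_b m r p) \<and>
      hardy_littlewood_ineq TYPE(complex) m r (ereal p) (exponent_b m r p) \<and>
      optimal_exponent TYPE(complex) m r (ereal p) (exponent_b m r p)"
    if c: "2 \<le> r" "real m < p" "p \<le> 2 * real m" for r p
  proof -
    have r: "0 < r" using c by simp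
    have p0: "0 < ereal p" using c(2) m by simp
    show ?thesis
      using hardy_littlewood_real[OF array_ineq_exponent_b[OF assms c] r p0]
        hardy_littlewood_complex[OF array_ineq_exponent_b[OF assms c] r p0]
        optimal_exponent_b[OF m c(1,2), where ?'a = real] optimal_exponent_b[OF m c(1,2), where ?'a = complex]
      by blast
  qed
  ultimately show ?thesis by blast
qed

end
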